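(* Let $f\colon X\to Y$ be a $1$-Lipschitz map between compact metric spaces, and let $d\ge 0$ be an integer. Then the persistent cost $C(f)$ of $f$ on degree-$d$ Vietoris--Rips persistent homology satisfies $$C(f)\le \operatorname{dist}(f)+2\, d_H(f(X),Y),$$ where $\operatorname{dist}(f)$ is the distortion of $f$ and $d_H(f(X),Y)$ is the Hausdorff distance in $Y$ between the image $f(X)$ and $Y$.
   Context: A map $f\colon X\to Y$ of metric spaces is $1$-Lipschitz if $d_Y(f(x),f(x'))\le d_X(x,x')$ for all $x,x'\in X$. Its distortion is $\operatorname{dist}(f)=\sup_{x,x'\in X}|d_Y(f(x),f(x'))-d_X(x,x')|$. For a metric space $X$ and $s\ge 0$, the Vietoris--Rips complex $\mathrm{VR}_s(X)$ is the abstract simplicial complex whose simplices are the finite nonempty subsets of $X$ of diameter at most $s$. Degree-$d$ simplicial homology with coefficients in a fixed field gives a persistence module $\mathrm{H}_d(\mathrm{VR}_\bullet(X))$, i.e. a functor from the poset of scale parameters to vector spaces, with transition maps induced by inclusions. A $1$-Lipschitz map $f\colon X\to Y$ induces simplicial maps $\mathrm{VR}_s(X)\to\mathrm{VR}_s(Y)$ and hence a homomorphism (natural transformation) $f_*\colon \mathrm{H}_d(\mathrm{VR}_\bullet(X))\to \mathrm{H}_d(\mathrm{VR}_\bullet(Y))$. An $\epsilon$-interleaving between persistence modules $V_\bullet,W_\bullet$ is a pair of natural transformations $P\colon V_\bullet\to W_{\bullet+\epsilon}$, $Q\colon W_\bullet\to V_{\bullet+\epsilon}$ such that $Q_{s+\epsilon}\circ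 P_s$ and $P_{s+\epsilon}\circ Q_s$ are the transition maps $V_s\to V_{s+2\epsilon}$ and $W_s\to W_{s+2\epsilon}$ for all $s$. The interleaving distance $d_I(V_\bullet,W_\bullet)\in[0,+\infty]$ is the infimum of all $\epsilon\ge 0$ for which an $\epsilon$-interleaving exists. The modules $\operatorname{Ker}(f_* )$ and $\operatorname{Coker}(f_* )$ are the pointwise kernel and cokernel with induced transition maps, and $\Delta$ is the trivial (zero) persistence module. The persistent cost of $f$ (in degree $d$) is $$C(f)=\max\{d_I(\operatorname{Ker}(f_* ),\Delta),\ d_I(\operatorname{Coker}(f_* ),\Delta)\}.$$ *)

theory Defs
  imports "HOL-Analysis.Analysis" "HOL-Algebra.Module" "HOL-Algebra.AbelCoset"
    "HOL-Library.Poly_Mapping"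
begin

section \<open>Linear maps, quotients and induced maps\<close>

text \<open>The coefficient field is a type of class \<^class>\<open>field\<close>, so scalars range over the whole type.
  Vector spaces are \<open>HOL-Algebra\<close> module records over it; the multiplicative
  fields of these records carry no information.\<close>

definition linear_maps :: "('k, 'v) module \<Rightarrow> ('k, 'w) module \<Rightarrow> ('v \<Rightarrow> 'w) set" where
  "linear_maps V W = {h \<in> carrier V \<rightarrow> carrier W.
     (\<forall>x\<in>carrier V. \<forall>y\<in>carrier V. h (x \<oplus>\<^bsub>V\<^esub> y) = h x \<oplus>\<^bsub>W\<^esub> h y) \<and>
     (\<forall>a. \<forall>x\<in>carrier V. h (a \<odot>\<^bsub>V\<^esub> x) = a \<odot>\<^bsub>W\<^esub> h x)}"

definition quot_module :: "('k, 'v) module \<Rightarrow> 'v set \<Rightarrow> ('k, 'v set) module" where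
  "quot_module V N =
     \<lparr>carrier = a_rcosets\<^bsub>V\<^esub> N, monoid.mult = undefined, one = undefined,
      zero = N, add = (\<lambda>C D. C <+>\<^bsub>V\<^esub> D),
      smult = (\<lambda>a C. \<Union>c\<in>C. N +>\<^bsub>V\<^esub> (a \<odot>\<^bsub>V\<^esub> c))\<rparr>"

text \<open>If \<open>h\<close> sends \<open>M\<close> into \<open>N\<close>, all cosets in the following union coincide, and this is the map
  \<open>V / M \<rightarrow> W / N\<close> induced by \<open>h : V \<rightarrow> W\<close>.\<close>

definition quot_map :: "('k, 'w) module \<Rightarrow> 'w set \<Rightarrow> ('v \<Rightarrow> 'w) \<Rightarrow> 'v set \<Rightarrow> 'w set" where
  "quot_map W N h C = (\<Union>c\<in>C. N +>\<^bsub>W\<^esub> h c)"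


section \<open>Oriented simplicial homology over a field\<close>

text \<open>A simplicial complex is given by its set \<open>K\<close> of (finite, nonempty) simplices.
  An ordered \<open>n\<close>-simplex is a list \<open>[v\<^sub>0, \<dots>, v\<^sub>n]\<close> of vertices, possibly repeated, whose
  underlying set is a simplex.\<close>

type_synonym ('a, 'k) chain = "'a list \<Rightarrow>\<^sub>0 'k"

definition ordered_simplices :: "nat \<Rightarrow> 'a set set \<Rightarrow> 'a list set" where
  "ordered_simplices n K = {xs. length xs = n + 1 \<and> set xs \<in> K}"

definition chain_scale :: "'k::field \<Rightarrow> ('a, 'k) chain \<Rightarrow> ('a, 'k) chain" where
  "chain_scale a c = Poly_Mapping.map (\<lambda>b. a * b) c"

definition linear_extend ::
  "('a list \<Rightarrow> ('b, 'k::field) chain) \<Rightarrow> ('a, 'k) chain \<Rightarrow> ('b, 'k) chain" where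
  "linear_extend g c =
     (\<Sum>xs\<in>Poly_Mapping.keys c. chain_scale (Poly_Mapping.lookup c xs) (g xs))"

definition ordered_chains :: "nat \<Rightarrow> 'a set set \<Rightarrow> ('k::field, ('a, 'k) chain) module" where
  "ordered_chains n K =
     \<lparr>carrier = {c. Poly_Mapping.keys c \<subseteq> ordered_simplices n K},
      monoid.mult = undefined, one = undefined, zero = 0, add = (+), smult = chain_scale\<rparr>"

text \<open>Oriented chains are ordered chains modulo \<open>[v\<^bsub>\<pi>0\<^esub>, \<dots>, v\<^bsub>\<pi>n\<^esub>] = sgn \<pi> [v\<^sub>0, \<dots>, v\<^sub>n]\<close> for all
  permutations \<open>\<pi>\<close>, and \<open>[v\<^sub>0, \<dots>, v\<^sub>n] = 0\<close> if a vertex is repeated. As the symmetric group is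
  generated by adjacent transpositions, it suffices to impose this for those and for adjacent
  repetitions; the latter are listed separately because of characteristic 2.\<close>

definition orientation_relations :: "nat \<Rightarrow> 'a set set \<Rightarrow> ('a, 'k::field) chain set" where
  "orientation_relations n K = Modules.module.span chain_scale
     ({Poly_Mapping.single (us @ [a, b] @ vs) 1 + Poly_Mapping.single (us @ [b, a] @ vs) 1
         | us a b vs. us @ [a, b] @ vs \<in> ordered_simplices n K} \<union>
      {Poly_Mapping.single (us @ [a, a] @ vs) 1
         | us a vs. us @ [a, a] @ vs \<in> ordered_simplices n K})"

definition oriented_chains :: "nat \<Rightarrow> 'a set set \<Rightarrow> ('k::field, ('a, 'k) chain set) module" where
  "oriented_chains n K = quot_module (ordered_chains n K) (orientation_relations n K)"

definition boundary_simplex :: "'a list \<Rightarrow> ('a, 'k::field) chain" where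
  "boundary_simplex xs =
     (\<Sum>i<length xs. Poly_Mapping.single (take i xs @ drop (Suc i) xs) ((- 1) ^ i))"

text \<open>\<open>boundary n K\<close> goes from oriented \<open>(n + 1)\<close>-chains to oriented \<open>n\<close>-chains. The complex is not
  augmented: every \<open>0\<close>-chain is a cycle.\<close>

definition boundary ::
  "nat \<Rightarrow> 'a set set \<Rightarrow> ('a, 'k::field) chain set \<Rightarrow> ('a, 'k) chain set" where
  "boundary n K =
     quot_map (ordered_chains n K) (orientation_relations n K) (linear_extend boundary_simplex)"

definition cycles :: "nat \<Rightarrow> 'a set set \<Rightarrow> ('a, 'k::field) chain set set" where
  "cycles n K = (case n of
      0 \<Rightarrow> carrier (oriented_chains 0 K)
    | Suc m \<Rightarrow> a_kernel (oriented_chains (Suc m) K) (oriented_chains m K) (boundary m K))"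

definition boundaries :: "nat \<Rightarrow> 'a set set \<Rightarrow> ('a, 'k::field) chain set set" where
  "boundaries n K = boundary n K ` carrier (oriented_chains (Suc n) K)"

definition homology :: "nat \<Rightarrow> 'a set set \<Rightarrow> ('k::field, ('a, 'k) chain set set) module" where
  "homology n K = quot_module (oriented_chains n K\<lparr>carrier := cycles n K\<rparr>) (boundaries n K)"

text \<open>The maps induced by a simplicial map \<open>f\<close> into the complex \<open>L\<close>.\<close>

definition chain_map ::
  "nat \<Rightarrow> 'b set set \<Rightarrow> ('a \<Rightarrow> 'b) \<Rightarrow> ('a, 'k::field) chain set \<Rightarrow> ('b, 'k) chain set" where
  "chain_map n L f =
     quot_map (ordered_chains n L) (orientation_relations n L)
       (linear_extend (\<lambda>xs. Poly_Mapping.single (map f xs) 1))"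

definition homology_map ::
  "nat \<Rightarrow> 'b set set \<Rightarrow> ('a \<Rightarrow> 'b) \<Rightarrow>
     ('a, 'k::field) chain set set \<Rightarrow> ('b, 'k) chain set set" where
  "homology_map n L f = quot_map (oriented_chains n L) (boundaries n L) (chain_map n L f)"


section \<open>Persistence modules\<close>

text \<open>Scale parameters range over \<open>[0, \<infinity>)\<close>; only the values of \<open>pspace\<close> at \<open>s \<ge> 0\<close> and of
  \<open>ptrans s t\<close> at \<open>0 \<le> s \<le> t\<close> matter. A morphism is a family of maps indexed by the scale.\<close>

record ('k, 'v) pmodule =
  pspace :: "real \<Rightarrow> ('k, 'v) module"
  ptrans :: "real \<Rightarrow> real \<Rightarrow> 'v \<Rightarrow> 'v"

definition zero_pmodule :: "('k, unit) pmodule" where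
  "zero_pmodule =
     \<lparr>pspace = (\<lambda>_. \<lparr>carrier = {()}, monoid.mult = (\<lambda>_ _. ()), one = (), zero = (),
                     add = (\<lambda>_ _. ()), smult = (\<lambda>_ _. ())\<rparr>),
      ptrans = (\<lambda>_ _ x. x)\<rparr>"

definition ker_pmodule ::
  "('k, 'v) pmodule \<Rightarrow> ('k, 'w) pmodule \<Rightarrow> (real \<Rightarrow> 'v \<Rightarrow> 'w) \<Rightarrow> ('k, 'v) pmodule" where
  "ker_pmodule V W F =
     \<lparr>pspace = (\<lambda>s. pspace V s\<lparr>carrier := a_kernel (pspace V s) (pspace W s) (F s)\<rparr>),
      ptrans = ptrans V\<rparr>"

definition coker_pmodule ::
  "('k, 'v) pmodule \<Rightarrow> ('k, 'w) pmodule \<Rightarrow> (real \<Rightarrow> 'v \<Rightarrow> 'w) \<Rightarrow> ('k, 'w set) pmodule" where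
  "coker_pmodule V W F =
     \<lparr>pspace = (\<lambda>s. quot_module (pspace W s) (F s ` carrier (pspace V s))),
      ptrans = (\<lambda>s t. quot_map (pspace W t) (F t ` carrier (pspace V t)) (ptrans W s t))\<rparr>"

text \<open>A natural transformation from \<open>V\<close> to the shifted module \<open>s \<mapsto> W (s + e)\<close>.\<close>

definition natural_shift ::
  "real \<Rightarrow> ('k, 'v) pmodule \<Rightarrow> ('k, 'w) pmodule \<Rightarrow> (real \<Rightarrow> 'v \<Rightarrow> 'w) \<Rightarrow> bool" where
  "natural_shift e V W P \<longleftrightarrow>
     (\<forall>s\<ge>0. P s \<in> linear_maps (pspace V s) (pspace W (s + e))) \<and>
     (\<forall>s\<ge>0. \<forall>t\<ge>s. \<forall>x\<in>carrier (pspace V s).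
        P t (ptrans V s t x) = ptrans W (s + e) (t + e) (P s x))"

definition interleaving ::
  "real \<Rightarrow> ('k, 'v) pmodule \<Rightarrow> ('k, 'w) pmodule \<Rightarrow>
     (real \<Rightarrow> 'v \<Rightarrow> 'w) \<Rightarrow> (real \<Rightarrow> 'w \<Rightarrow> 'v) \<Rightarrow> bool" where
  "interleaving e V W P Q \<longleftrightarrow>
     natural_shift e V W P \<and> natural_shift e W V Q \<and>
     (\<forall>s\<ge>0. \<forall>x\<in>carrier (pspace V s). Q (s + e) (P s x) = ptrans V s (s + 2 * e) x) \<and>
     (\<forall>s\<ge>0. \<forall>y\<in>carrier (pspace W s). P (s + e) (Q s y) = ptrans W s (s + 2 * e) y)"

definition interleaving_distance :: "('k, 'v) pmodule \<Rightarrow> ('k, 'w) pmodule \<Rightarrow> ennreal" where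
  "interleaving_distance V W = Inf {ennreal e | e. 0 \<le> e \<and> (\<exists>P Q. interleaving e V W P Q)}"


section \<open>Vietoris--Rips persistence and persistent cost\<close>

definition vietoris_rips :: "real \<Rightarrow> 'a::metric_space set \<Rightarrow> 'a set set" where
  "vietoris_rips s X = {S. finite S \<and> S \<noteq> {} \<and> S \<subseteq> X \<and> diameter S \<le> s}"

definition vr_homology ::
  "nat \<Rightarrow> 'a::metric_space set \<Rightarrow> ('k::field, ('a, 'k) chain set set) pmodule" where
  "vr_homology d X =
     \<lparr>pspace = (\<lambda>s. homology d (vietoris_rips s X)),
      ptrans = (\<lambda>s t. homology_map d (vietoris_rips t X) (\<lambda>x. x))\<rparr>"

definition vr_homology_map ::
  "nat \<Rightarrow> 'b::metric_space set \<Rightarrow> ('a \<Rightarrow> 'b) \<Rightarrow>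
     real \<Rightarrow> ('a, 'k::field) chain set set \<Rightarrow> ('b, 'k) chain set set" where
  "vr_homology_map d Y f s = homology_map d (vietoris_rips s Y) f"

text \<open>The \<^typ>\<open>'k itself\<close> argument selects the coefficient field.\<close>

definition persistent_cost ::
  "'k::field itself \<Rightarrow> nat \<Rightarrow> 'a::metric_space set \<Rightarrow> 'b::metric_space set \<Rightarrow> ('a \<Rightarrow> 'b) \<Rightarrow> ennreal"
  where
  "persistent_cost _ d X Y f =
     (let V = (vr_homology d X :: ('k, ('a, 'k) chain set set) pmodule);
          W = (vr_homology d Y :: ('k, ('b, 'k) chain set set) pmodule);
          F = vr_homology_map d Y f
      in max (interleaving_distance (ker_pmodule V W F) zero_pmodule)
             (interleaving_distance (coker_pmodule V W F) zero_pmodule))"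

definition distortion :: "'a::metric_space set \<Rightarrow> ('a \<Rightarrow> 'b::metric_space) \<Rightarrow> ennreal" where
  "distortion X f = (SUP (x, x')\<in>X \<times> X. ennreal \<bar>dist (f x) (f x') - dist x x'\<bar>)"

text \<open>In \<^typ>\<open>ennreal\<close>, the distance from the empty set to a nonempty set is \<open>\<infinity>\<close>.\<close>

definition hausdorff_distance :: "'a::metric_space set \<Rightarrow> 'a set \<Rightarrow> ennreal" where
  "hausdorff_distance A B =
     max (SUP a\<in>A. INF b\<in>B. ennreal (dist a b)) (SUP b\<in>B. INF a\<in>A. ennreal (dist a b))"

end

theory Submission
  imports Defs
begin

text \<open>Write \<open>\<delta>\<close> for the distortion of \<open>f\<close> and let \<open>\<eta>\<close> exceed the Hausdorff distance from \<open>f(X)\<close> to \<open>Y\<close>.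
  Choosing for each \<open>y\<close> a point \<open>g y\<close> of \<open>X\<close> whose image is within \<open>\<eta>\<close> of \<open>y\<close> gives a map
  \<open>g : Y \<rightarrow> X\<close> that stretches distances by at most \<open>\<delta> + 2\<eta>\<close>. If \<open>e \<ge> \<delta> + 2\<eta>\<close>, then \<open>g\<close> is simplicial
  from the Rips complex of \<open>Y\<close> at scale \<open>s\<close> to that of \<open>X\<close> at scale \<open>s + e\<close>, and on these complexes
  both \<open>g \<circ> f\<close> and \<open>f \<circ> g\<close> are contiguous to the inclusions. In homology this says that
  \<open>g\<^sub>* f\<^sub>*\<close> and \<open>f\<^sub>* g\<^sub>*\<close> are the transition maps. Hence a class killed by \<open>f\<^sub>*\<close> dies after
  a shift by \<open>e\<close>, and after such a shift every class of \<open>Y\<close> lies in the image of \<open>f\<^sub>*\<close>: the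
  transition maps of the kernel and of the cokernel vanish. A persistence module whose transition
  maps over \<open>2 e\<close> vanish is \<open>e\<close>-interleaved with zero (\<open>interleaving_zero\<close>). Letting \<open>\<eta>\<close> tend
  to the Hausdorff distance gives the bound.

  The algebraic input is that contiguous maps induce the same map in homology
  (\<open>contiguous_homologous\<close>). The usual prism operator is compatible with orientations only
  after the vertices have been ordered. Instead the two maps are compared on one cycle, which has
  finitely many vertices, and these are moved from their first image to their second one at a
  time. When a single vertex \<open>v\<close> moves from \<open>f v\<close> to \<open>w\<close>, the homotopy is, in terms of exterior
  algebra, \<open>\<omega> \<mapsto> f v \<and> w \<and> f\<^sub>*(\<iota>\<^sub>v \<omega>)\<close> with \<open>\<iota>\<^sub>v\<close> the contraction with the dual of \<open>v\<close>. This formula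
  is manifestly alternating, so it descends to oriented chains (\<open>homotopy_relations\<close>), and it is an
  exact homotopy on simplices without repeated vertices (\<open>prism_homotopy\<close>); the remaining
  simplices are relations themselves (\<open>relations_not_distinct\<close>).\<close>

section \<open>Linear maps and quotients of module records\<close>

text \<open>A vector space record, seen as an abelian group on which each scalar acts by an endomorphism:
  the structure under which cosets are added and scaled through representatives.\<close>

locale lin_space = abelian_group V for V :: "('k, 'v) module" (structure) +
  assumes smult_closed [simp, intro]: "x \<in> carrier V \<Longrightarrow> a \<odot> x \<in> carrier V"
    and smult_add: "\<lbrakk>x \<in> carrier V; y \<in> carrier V\<rbrakk> \<Longrightarrow> a \<odot> (x \<oplus> y) = a \<odot> x \<oplus> a \<odot> y"

locale lin_subspace = lin_space V + additive_subgroup N V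
  for N :: "'v set" and V :: "('k, 'v) module" (structure) +
  assumes smult_mem: "x \<in> N \<Longrightarrow> a \<odot> x \<in> N"

sublocale lin_subspace \<subseteq> abelian_subgroup N V
  by (intro abelian_subgroupI3 additive_subgroup_axioms abelian_group_axioms)

lemma (in lin_space) smult_zero [simp]: "a \<odot> \<zero> = \<zero>"
proof -
  have "a \<odot> \<zero> \<oplus> a \<odot> \<zero> = a \<odot> \<zero> \<oplus> \<zero>"
    using smult_add[of \<zero> \<zero> a] by simp
  then show ?thesis by (simp del: r_zero)
qed

lemma linear_mapsD:
  assumes "h \<in> linear_maps V W"
  shows "x \<in> carrier V \<Longrightarrow> h x \<in> carrier W"
    and "x \<in> carrier V \<Longrightarrow> y \<in> carrier V \<Longrightarrow> h (x \<oplus>\<^bsub>V\<^esub> y) = h x \<oplus>\<^bsub>W\<^esub> h y"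
    and "x \<in> carrier V \<Longrightarrow> h (a \<odot>\<^bsub>V\<^esub> x) = a \<odot>\<^bsub>W\<^esub> h x"
  using assms by (auto simp: linear_maps_def)

lemma linear_maps_restrict:
  assumes "h \<in> linear_maps V W" and "M \<subseteq> carrier V" and "\<And>x. x \<in> M \<Longrightarrow> h x \<in> N"
  shows "h \<in> linear_maps (V\<lparr>carrier := M\<rparr>) (W\<lparr>carrier := N\<rparr>)"
  using assms by (auto simp: linear_maps_def subset_iff)

lemma linear_maps_hom:
  assumes "lin_space V" and "lin_space W" and "h \<in> linear_maps V W"
  shows "abelian_group_hom V W h"
proof -
  interpret V: lin_space V by fact
  interpret W: lin_space W by fact
  show ?thesis
    by (intro abelian_group_homI V.abelian_group_axioms W.abelian_group_axioms group_hom.intro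
        V.a_group W.a_group group_hom_axioms.intro)
       (use assms(3) in \<open>auto simp: hom_def linear_maps_def\<close>)
qed

lemma linear_maps_zero:
  "lin_space V \<Longrightarrow> lin_space W \<Longrightarrow> h \<in> linear_maps V W \<Longrightarrow> h \<zero>\<^bsub>V\<^esub> = \<zero>\<^bsub>W\<^esub>"
  by (intro abelian_group_hom.hom_zero linear_maps_hom)

lemma lin_subspace_carrier:
  assumes "lin_space V"
  shows "lin_subspace (carrier V) V"
proof -
  interpret lin_space V by fact
  show ?thesis
    by unfold_locales (auto intro!: add.subgroup_self simp: a_inv_def[symmetric] intro: add.inv_closed)
qed

lemma lin_subspace_image:
  assumes "lin_space V" and "lin_space W" and h: "h \<in> linear_maps V W"
  shows "lin_subspace (h ` carrier V) W"
proof -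
  interpret V: lin_space V by fact
  interpret W: lin_space W by fact
  interpret h: abelian_group_hom V W h by (rule linear_maps_hom) fact+
  have "subgroup (h ` carrier V) (add_monoid W)"
    using group_hom.img_is_subgroup[OF h.a_group_hom] by simp
  then show ?thesis
    using linear_mapsD(3)[OF h, symmetric]
    by (intro lin_subspace.intro additive_subgroup.intro lin_subspace_axioms.intro)
       (auto intro: W.lin_space_axioms)
qed

lemma lin_subspace_kernel:
  assumes "lin_space V" and "lin_space W" and h: "h \<in> linear_maps V W"
  shows "lin_subspace (a_kernel V W h) V"
proof -
  interpret V: lin_space V by fact
  interpret W: lin_space W by fact
  interpret h: abelian_group_hom V W h by (rule linear_maps_hom) fact+
  show ?thesis
    using linear_mapsD(3)[OF h]
    by (intro lin_subspace.intro h.additive_subgroup_a_kernel lin_subspace_axioms.intro)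
       (auto intro: V.lin_space_axioms simp: a_kernel_def')
qed

lemma lin_space_restrict:
  assumes "lin_subspace N V"
  shows "lin_space (V\<lparr>carrier := N\<rparr>)"
proof -
  interpret lin_subspace N V by fact
  show ?thesis
  proof (intro lin_space.intro lin_space_axioms.intro abelian_groupI)
    fix x assume "x \<in> carrier (V\<lparr>carrier := N\<rparr>)"
    then show "\<exists>y\<in>carrier (V\<lparr>carrier := N\<rparr>). y \<oplus>\<^bsub>V\<lparr>carrier := N\<rparr>\<^esub> x = \<zero>\<^bsub>V\<lparr>carrier := N\<rparr>\<^esub>"
      by (auto intro!: bexI[of _ "\<ominus>\<^bsub>V\<^esub> x"] l_neg)
  qed (auto simp: a_ac smult_mem smult_add)
qed

lemma lin_subspace_restrict:
  assumes M: "lin_subspace M V" and N: "lin_subspace N V" and "M \<subseteq> N"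
  shows "lin_subspace M (V\<lparr>carrier := N\<rparr>)"
proof -
  interpret M: lin_subspace M V by fact
  interpret N: lin_space "V\<lparr>carrier := N\<rparr>" by (rule lin_space_restrict[OF N])
  have inv: "\<ominus>\<^bsub>V\<lparr>carrier := N\<rparr>\<^esub> x = \<ominus>\<^bsub>V\<^esub> x" if "x \<in> M" for x
    using that assms(3) N.minus_equality[of "\<ominus>\<^bsub>V\<^esub> x" x] M.l_neg[of x] by (auto simp: subset_iff)
  show ?thesis
  proof (intro lin_subspace.intro additive_subgroup.intro lin_subspace_axioms.intro
      N.lin_space_axioms N.add.subgroupI)
  qed (use assms(3) inv M.zero_closed in \<open>auto simp: M.smult_mem a_inv_def[symmetric] simp del: M.zero_closed\<close>)
qed

lemma quot_module_simps [simp]: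
  "carrier (quot_module V N) = (\<lambda>x. N +>\<^bsub>V\<^esub> x) ` carrier V"
  "\<zero>\<^bsub>quot_module V N\<^esub> = N"
  "C \<oplus>\<^bsub>quot_module V N\<^esub> D = C <+>\<^bsub>V\<^esub> D"
  "a \<odot>\<^bsub>quot_module V N\<^esub> C = quot_map V N (\<lambda>c. a \<odot>\<^bsub>V\<^esub> c) C"
  by (auto simp: quot_module_def A_RCOSETS_def' quot_map_def)

text \<open>The union that defines \<open>quot_map\<close> runs over representatives whose images all lie in one coset,
  because \<open>h\<close> sends \<open>M\<close> into \<open>N\<close>. The map \<open>h\<close> is only required to be additive, so this also covers
  scalar multiplication on a quotient.\<close>

lemma quot_map_coset:
  assumes "lin_subspace M V" and "lin_subspace N W"
    and hV: "\<And>x. x \<in> carrier V \<Longrightarrow> h x \<in> carrier W"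
    and hadd: "\<And>x y. x \<in> carrier V \<Longrightarrow> y \<in> carrier V \<Longrightarrow> h (x \<oplus>\<^bsub>V\<^esub> y) = h x \<oplus>\<^bsub>W\<^esub> h y"
    and hM: "\<And>x. x \<in> M \<Longrightarrow> h x \<in> N" and x: "x \<in> carrier V"
  shows "quot_map W N h (M +>\<^bsub>V\<^esub> x) = N +>\<^bsub>W\<^esub> h x"
proof -
  interpret M: lin_subspace M V by fact
  interpret N: lin_subspace N W by fact
  have "N +>\<^bsub>W\<^esub> h (m \<oplus>\<^bsub>V\<^esub> x) = N +>\<^bsub>W\<^esub> h x" if m: "m \<in> M" for m
  proof -
    have "h (m \<oplus>\<^bsub>V\<^esub> x) = h m \<oplus>\<^bsub>W\<^esub> h x" using m x by (intro hadd) auto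
    moreover have "(N +>\<^bsub>W\<^esub> h m) +>\<^bsub>W\<^esub> h x = N +>\<^bsub>W\<^esub> (h m \<oplus>\<^bsub>W\<^esub> h x)"
      using m x hV by (intro N.a_coset_add_assoc N.a_subset) auto
    ultimately show ?thesis using N.a_rcos_const[OF hM[OF m]] by simp
  qed
  moreover have "M +>\<^bsub>V\<^esub> x = (\<lambda>m. m \<oplus>\<^bsub>V\<^esub> x) ` M"
    by (auto simp: a_r_coset_def')
  moreover have "M \<noteq> {}" using M.zero_closed by blast
  ultimately show ?thesis by (auto simp: quot_map_def)
qed

lemma (in lin_subspace) smult_coset:
  "x \<in> carrier V \<Longrightarrow> quot_map V N (\<lambda>c. a \<odot> c) (N +> x) = N +> a \<odot> x"
  by (rule quot_map_coset) (auto intro: lin_subspace_axioms smult_add smult_mem)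

lemma (in lin_subspace) lin_space_quot: "lin_space (quot_module V N)"
proof (intro lin_space.intro lin_space_axioms.intro abelian_groupI)
  show "\<zero>\<^bsub>quot_module V N\<^esub> \<in> carrier (quot_module V N)"
    using a_coset_add_zero[OF a_subset] by (auto intro!: image_eqI[of _ _ \<zero>])
next
  fix C assume "C \<in> carrier (quot_module V N)"
  then obtain x where x: "x \<in> carrier V" "C = N +> x" by auto
  then show "\<exists>D\<in>carrier (quot_module V N). D \<oplus>\<^bsub>quot_module V N\<^esub> C = \<zero>\<^bsub>quot_module V N\<^esub>"
    using a_coset_add_zero[OF a_subset]
    by (intro bexI[of _ "N +> \<ominus> x"]) (simp_all add: a_rcos_sum l_neg)
  show "\<zero>\<^bsub>quot_module V N\<^esub> \<oplus>\<^bsub>quot_module V N\<^esub> C = C"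
    using x a_rcos_sum[of \<zero> x] a_coset_add_zero[OF a_subset] by simp
next
  fix C D assume "C \<in> carrier (quot_module V N)" "D \<in> carrier (quot_module V N)"
  then obtain x y where "x \<in> carrier V" "C = N +> x" "y \<in> carrier V" "D = N +> y" by auto
  then show "C \<oplus>\<^bsub>quot_module V N\<^esub> D \<in> carrier (quot_module V N)"
    and "C \<oplus>\<^bsub>quot_module V N\<^esub> D = D \<oplus>\<^bsub>quot_module V N\<^esub> C"
    and "a \<odot>\<^bsub>quot_module V N\<^esub> (C \<oplus>\<^bsub>quot_module V N\<^esub> D) =
      a \<odot>\<^bsub>quot_module V N\<^esub> C \<oplus>\<^bsub>quot_module V N\<^esub> a \<odot>\<^bsub>quot_module V N\<^esub> D" for a
    by (simp_all add: a_rcos_sum smult_coset smult_add a_comm)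
next
  fix C D E
  assume "C \<in> carrier (quot_module V N)" "D \<in> carrier (quot_module V N)" "E \<in> carrier (quot_module V N)"
  then show "C \<oplus>\<^bsub>quot_module V N\<^esub> D \<oplus>\<^bsub>quot_module V N\<^esub> E =
      C \<oplus>\<^bsub>quot_module V N\<^esub> (D \<oplus>\<^bsub>quot_module V N\<^esub> E)"
    by (auto simp: a_rcos_sum a_assoc)
next
  fix C a assume "C \<in> carrier (quot_module V N)"
  then show "a \<odot>\<^bsub>quot_module V N\<^esub> C \<in> carrier (quot_module V N)"
    by (auto simp: smult_coset)
qed

lemma (in lin_subspace) coset_linear: "(\<lambda>x. N +> x) \<in> linear_maps V (quot_module V N)"
  by (auto simp: linear_maps_def a_rcos_sum smult_coset)

lemma quot_map_linear:
  assumes M: "lin_subspace M V" and N: "lin_subspace N W"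
    and h: "h \<in> linear_maps V W" and hM: "\<And>x. x \<in> M \<Longrightarrow> h x \<in> N"
  shows "quot_map W N h \<in> linear_maps (quot_module V M) (quot_module W N)"
proof -
  interpret M: lin_subspace M V by fact
  interpret N: lin_subspace N W by fact
  note D = linear_mapsD[OF h]
  have "quot_map W N h (M +>\<^bsub>V\<^esub> x) = N +>\<^bsub>W\<^esub> h x" if "x \<in> carrier V" for x
    by (rule quot_map_coset[OF M N D(1,2) hM that])
  then show ?thesis
    by (auto simp: linear_maps_def M.a_rcos_sum N.a_rcos_sum M.smult_coset N.smult_coset D)
qed

lemma (in lin_subspace) coset_eqI:
  assumes "x \<in> carrier V" "n \<in> N"
  shows "N +> (n \<oplus> x) = N +> x"
  using assms a_coset_add_assoc[OF a_subset, of n x] a_rcos_const[of n] by auto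

lemma (in lin_subspace) coset_eq_zero_iff: "x \<in> carrier V \<Longrightarrow> N +> x = N \<longleftrightarrow> x \<in> N"
  using a_rcos_const a_rcos_self by blast

section \<open>Linear maps between spaces of ordered chains\<close>

lemma lookup_chain_scale [simp]:
  "Poly_Mapping.lookup (chain_scale a c) xs = a * Poly_Mapping.lookup c xs"
  by (simp add: chain_scale_def Poly_Mapping.map.rep_eq when_def)

lemma module_chain_scale: "Modules.module (chain_scale :: 'k::field \<Rightarrow> ('a, 'k) chain \<Rightarrow> ('a, 'k) chain)"
  by unfold_locales (auto intro!: poly_mapping_eqI simp: lookup_add algebra_simps)

interpretation chains: Modules.module "chain_scale :: 'k::field \<Rightarrow> ('a, 'k) chain \<Rightarrow> ('a, 'k) chain"
  by (rule module_chain_scale)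

interpretation chain_pair: module_pair
  "chain_scale :: 'k::field \<Rightarrow> ('a, 'k) chain \<Rightarrow> ('a, 'k) chain"
  "chain_scale :: 'k::field \<Rightarrow> ('b, 'k) chain \<Rightarrow> ('b, 'k) chain"
  by unfold_locales

abbreviation chain_hom :: "(('a, 'k::field) chain \<Rightarrow> ('b, 'k) chain) \<Rightarrow> bool" where
  "chain_hom \<equiv> module_hom chain_scale chain_scale"

lemma linear_extend_superset:
  assumes "finite S" and "Poly_Mapping.keys c \<subseteq> S"
  shows "linear_extend g c = (\<Sum>xs\<in>S. chain_scale (Poly_Mapping.lookup c xs) (g xs))"
  unfolding linear_extend_def using assms
  by (intro sum.mono_neutral_left) (auto simp: in_keys_iff)

lemma chain_hom_linear_extend:
  fixes g :: "'a list \<Rightarrow> ('b, 'k::field) chain"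
  shows "chain_hom (linear_extend g)"
proof (rule module_hom.intro[OF module_chain_scale module_chain_scale], unfold_locales)
  fix c c' :: "('a, 'k) chain"
  let ?S = "Poly_Mapping.keys c \<union> Poly_Mapping.keys c'"
  have "Poly_Mapping.keys (c + c') \<subseteq> ?S" by (rule Poly_Mapping.keys_add)
  then show "linear_extend g (c + c') = linear_extend g c + linear_extend g c'"
    by (subst (1 2 3) linear_extend_superset[of ?S])
       (auto simp: lookup_add chains.scale_left_distrib sum.distrib)
next
  fix a :: 'k and c :: "('a, 'k) chain"
  have "Poly_Mapping.keys (chain_scale a c) \<subseteq> Poly_Mapping.keys c"
    by (auto simp: in_keys_iff)
  then show "linear_extend g (chain_scale a c) = chain_scale a (linear_extend g c)"
    by (subst (1 2) linear_extend_superset[of "Poly_Mapping.keys c"])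
       (auto simp: chains.scale_sum_right)
qed

lemmas linear_extend_simps [simp] =
  module_hom.zero[OF chain_hom_linear_extend] module_hom.add[OF chain_hom_linear_extend]
  module_hom.diff[OF chain_hom_linear_extend] module_hom.neg[OF chain_hom_linear_extend]
  module_hom.sum[OF chain_hom_linear_extend] module_hom.scale[OF chain_hom_linear_extend]

lemma chain_scale_single [simp]:
  "chain_scale a (Poly_Mapping.single xs b) = Poly_Mapping.single xs (a * b)"
  by (rule poly_mapping_eqI) (simp add: lookup_single when_def)

lemma linear_extend_single [simp]:
  "linear_extend g (Poly_Mapping.single xs a) = chain_scale a (g xs)"
  by (cases "a = 0") (simp_all add: linear_extend_def)

lemma linear_extend_cong:
  assumes "\<And>xs. xs \<in> Poly_Mapping.keys c \<Longrightarrow> g xs = h xs"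
  shows "linear_extend g c = linear_extend h c"
  using assms by (simp add: linear_extend_def)

lemma chain_eq_sum: "c = linear_extend (\<lambda>xs. Poly_Mapping.single xs 1) c"
proof (rule poly_mapping_eqI)
  fix ys
  show "Poly_Mapping.lookup c ys =
      Poly_Mapping.lookup (linear_extend (\<lambda>xs. Poly_Mapping.single xs 1) c) ys"
    by (auto simp: linear_extend_def lookup_sum lookup_single when_def in_keys_iff
        sum.delta[of "Poly_Mapping.keys c"] if_distrib[of "\<lambda>x. _ * x"] cong: if_cong)
qed

text \<open>Membership statements about linear maps, and through them all identities between linear maps,
  are checked on single simplices or on the generators of a span; the next three lemmas are the form in which this is used.\<close>

lemma chain_hom_mem:
  assumes T: "chain_hom T" and W: "chains.subspace W"
    and "\<And>xs. xs \<in> Poly_Mapping.keys c \<Longrightarrow> T (Poly_Mapping.single xs 1) \<in> W"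
  shows "T c \<in> W"
proof -
  have "T c = (\<Sum>xs\<in>Poly_Mapping.keys c. chain_scale (Poly_Mapping.lookup c xs) (T (Poly_Mapping.single xs 1)))"
    by (subst chain_eq_sum)
       (simp only: linear_extend_def module_hom.sum[OF T] module_hom.scale[OF T])
  also have "\<dots> \<in> W"
    by (intro chains.subspace_sum[OF W] chains.subspace_scale[OF W] assms(3))
  finally show ?thesis .
qed

lemma chain_hom_eqI:
  assumes S: "chain_hom S" and T: "chain_hom T"
    and "\<And>xs. xs \<in> Poly_Mapping.keys c \<Longrightarrow> S (Poly_Mapping.single xs 1) = T (Poly_Mapping.single xs 1)"
  shows "S c = T c"
proof -
  have "S c - T c \<in> {0}"
    by (rule chain_hom_mem[where T = "\<lambda>c. S c - T c", OF chain_pair.module_hom_sub[OF S T]]) (use assms(3) in auto)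
  then show ?thesis by simp
qed

lemma chain_hom_span_mem:
  assumes T: "chain_hom T" and W: "chains.subspace W"
    and "\<And>x. x \<in> G \<Longrightarrow> T x \<in> W" and "c \<in> chains.span G"
  shows "T c \<in> W"
proof -
  have "chains.span G \<subseteq> T -` W"
    by (rule chains.span_minimal[OF _ module_hom.subspace_vimage[OF T W]]) (use assms(3) in auto)
  then show ?thesis using assms(4) by auto
qed

section \<open>The boundary and the prism over one moving vertex\<close>

abbreviation simplex_chain :: "'a list \<Rightarrow> ('a, 'k::field) chain" where
  "simplex_chain xs \<equiv> Poly_Mapping.single xs 1"

definition push :: "('a \<Rightarrow> 'b) \<Rightarrow> ('a, 'k::field) chain \<Rightarrow> ('b, 'k) chain" where
  "push f = linear_extend (\<lambda>xs. simplex_chain (map f xs))"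

definition bd :: "('a, 'k::field) chain \<Rightarrow> ('a, 'k) chain" where
  "bd = linear_extend boundary_simplex"

definition prepend :: "'a \<Rightarrow> ('a, 'k::field) chain \<Rightarrow> ('a, 'k) chain" where
  "prepend x = linear_extend (\<lambda>xs. simplex_chain (x # xs))"

text \<open>The homotopy for moving the vertex \<open>v\<close> from \<open>f v\<close> to \<open>w\<close>. Unfolding the recursion, each occurrence
  of \<open>v\<close> at position \<open>i\<close> contributes \<open>(-1)\<^sup>i\<close> times the image simplex with \<open>w\<close> inserted after \<open>f v\<close>;
  in exterior notation this is \<open>f v \<and> w \<and> f\<^sub>*(\<iota>\<^sub>v \<omega>)\<close>.\<close>

fun prism :: "('a \<Rightarrow> 'b) \<Rightarrow> 'a \<Rightarrow> 'b \<Rightarrow> 'a list \<Rightarrow> ('b, 'k::field) chain" where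
  "prism f v w [] = 0"
| "prism f v w (x # xs) =
     (if x = v then simplex_chain (f v # w # map f xs) else 0) - prepend (f x) (prism f v w xs)"

definition homotopy :: "('a \<Rightarrow> 'b) \<Rightarrow> 'a \<Rightarrow> 'b \<Rightarrow> ('a, 'k::field) chain \<Rightarrow> ('b, 'k) chain" where
  "homotopy f v w = linear_extend (prism f v w)"

lemma chain_homs [simp, intro]:
  "chain_hom (push f)" "chain_hom bd" "chain_hom (prepend x)" "chain_hom (homotopy f v w)"
  by (simp_all add: push_def bd_def prepend_def homotopy_def chain_hom_linear_extend)

lemma on_simplex_chain [simp]:
  "push f (simplex_chain xs) = simplex_chain (map f xs)"
  "bd (simplex_chain xs) = boundary_simplex xs"
  "prepend x (simplex_chain xs) = simplex_chain (x # xs)"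
  "homotopy f v w (simplex_chain xs) = prism f v w xs"
  by (simp_all add: push_def bd_def prepend_def homotopy_def)

lemmas chain_hom_simps [simp] =
  chain_homs(1)[THEN module_hom.zero] chain_homs(1)[THEN module_hom.add]
  chain_homs(1)[THEN module_hom.diff] chain_homs(1)[THEN module_hom.neg]
  chain_homs(2)[THEN module_hom.zero] chain_homs(2)[THEN module_hom.add]
  chain_homs(2)[THEN module_hom.diff] chain_homs(2)[THEN module_hom.neg]
  chain_homs(3)[THEN module_hom.zero] chain_homs(3)[THEN module_hom.add]
  chain_homs(3)[THEN module_hom.diff] chain_homs(3)[THEN module_hom.neg]
  chain_homs(4)[THEN module_hom.zero] chain_homs(4)[THEN module_hom.add]
  chain_homs(4)[THEN module_hom.diff] chain_homs(4)[THEN module_hom.neg]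

lemma chain_hom_comp: "chain_hom S \<Longrightarrow> chain_hom T \<Longrightarrow> chain_hom (\<lambda>c. S (T c))"
  using module_hom_compose[of chain_scale chain_scale T chain_scale S] by (simp add: comp_def)

lemmas chain_hom_intros = chain_homs chain_homs[THEN chain_hom_comp] chain_pair.module_hom_add
  chain_pair.module_hom_sub chain_pair.module_hom_zero chain_pair.module_hom_neg chains.module_hom_ident

lemma boundary_simplex_Nil [simp]: "boundary_simplex [] = 0"
  by (simp add: boundary_simplex_def)

text \<open>Deleting the first vertex gives the positive term, and any later deletion changes sign because
  its position drops by one in the tail. With the empty list as the only face of a vertex, this
  recursion holds for all lists and turns the identities below into inductions over lists.\<close>

lemma boundary_simplex_Cons [simp]:
  "boundary_simplex (x # xs) = simplex_chain xs - prepend x (boundary_simplex xs)"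
proof -
  have "boundary_simplex (x # xs) = simplex_chain xs +
     (\<Sum>i<length xs. Poly_Mapping.single (x # take i xs @ drop (Suc i) xs) (- ((- 1) ^ i)))"
    unfolding boundary_simplex_def by (simp add: sum.lessThan_Suc_shift del: sum.lessThan_Suc)
  also have "(\<Sum>i<length xs. Poly_Mapping.single (x # take i xs @ drop (Suc i) xs) (- ((- 1) ^ i)))
     = - prepend x (boundary_simplex xs)"
    unfolding boundary_simplex_def prepend_def by (simp add: sum_negf single_uminus)
  finally show ?thesis by simp
qed

lemma bd_prepend: "bd (prepend x c) = c - prepend x (bd c)"
  by (rule chain_hom_eqI[where S = "\<lambda>c. bd (prepend x c)"]) (auto intro!: chain_hom_intros)

lemma bd_bd:
  fixes c :: "('a, 'k::field) chain"
  shows "bd (bd c) = 0"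
proof (rule chain_hom_eqI[where S = "\<lambda>c. bd (bd c)" and T = "\<lambda>_. 0"])
  fix xs :: "'a list"
  show "bd (bd (simplex_chain xs)) = (0 :: ('a, 'k) chain)"
    by (induction xs) (auto simp: bd_prepend)
qed (auto intro!: chain_hom_intros)

lemma push_prepend: "push f (prepend x c) = prepend (f x) (push f c)"
  by (rule chain_hom_eqI[where S = "\<lambda>c. push f (prepend x c)"]) (auto intro!: chain_hom_intros)

lemma push_bd:
  fixes c :: "('a, 'k::field) chain"
  shows "push f (bd c) = bd (push f c)"
proof (rule chain_hom_eqI[where S = "\<lambda>c. push f (bd c)"])
  fix xs :: "'a list"
  show "push f (bd (simplex_chain xs)) = bd (push f (simplex_chain xs :: ('a, 'k) chain))"
    by (induction xs) (auto simp: push_prepend)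
qed (auto intro!: chain_hom_intros)

lemma push_push: "push g (push f c) = push (\<lambda>x. g (f x)) c"
  by (rule chain_hom_eqI[where S = "\<lambda>c. push g (push f c)"]) (auto intro!: chain_hom_intros simp: comp_def)

lemma push_ident [simp]: "push (\<lambda>x. x) c = c"
  by (rule chain_hom_eqI[where S = "\<lambda>c. push (\<lambda>x. x) c"]) (auto intro!: chain_hom_intros)

lemma homotopy_prepend:
  "homotopy f v w (prepend x c) =
     (if x = v then prepend (f v) (prepend w (push f c)) else 0) - prepend (f x) (homotopy f v w c)"
proof (cases "x = v")
  case True
  show ?thesis unfolding True if_True simp_thms
    by (rule chain_hom_eqI[where S = "\<lambda>c. homotopy f v w (prepend v c)"]) (auto intro!: chain_hom_intros)
next
  case False
  show ?thesis unfolding if_not_P[OF False]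
    by (rule chain_hom_eqI[where S = "\<lambda>c. homotopy f v w (prepend x c)"])
       (use False in \<open>auto intro!: chain_hom_intros\<close>)
qed

text \<open>For a list \<open>x # xs\<close> with \<open>x \<noteq> v\<close> the identity is the one for \<open>xs\<close> with \<open>f x\<close> prepended. For \<open>x = v\<close>
  the new term contributes \<open>w # map f xs\<close> and \<open>- f v # map f xs\<close>; since \<open>v\<close> does not occur again in
  \<open>xs\<close>, both maps agree on \<open>xs\<close> and this is the whole difference.\<close>

lemma prism_homotopy:
  assumes "distinct xs"
  shows "bd (prism f v w xs) + homotopy f v w (boundary_simplex xs) =
    simplex_chain (map (f(v := w)) xs) - (simplex_chain (map f xs) :: ('b, 'k::field) chain)"
  using assms
proof (induction xs)
  case (Cons x xs)
  have IH: "homotopy f v w (boundary_simplex xs) =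
      simplex_chain (map (f(v := w)) xs) - (simplex_chain (map f xs) :: ('b, 'k) chain) - bd (prism f v w xs)"
    using Cons.IH Cons.prems by (simp add: algebra_simps del: fun_upd_apply)
  have ps: "push f (boundary_simplex xs) = (boundary_simplex (map f xs) :: ('b, 'k) chain)"
    using push_bd[of f "simplex_chain xs :: ('a, 'k) chain"] by simp
  show ?case
  proof (cases "x = v")
    case True
    then have unchanged: "map (f(v := w)) xs = map f xs" using Cons.prems by auto
    show ?thesis
      unfolding fun_upd_def
      by (simp add: True bd_prepend homotopy_prepend IH[unfolded fun_upd_def] ps unchanged[unfolded fun_upd_def])
  next
    case False
    then show ?thesis
      unfolding fun_upd_def by (simp add: bd_prepend homotopy_prepend IH[unfolded fun_upd_def])
  qed
qed simp

section \<open>Orientation relations\<close>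

text \<open>The relations are first studied on the lists of length \<open>m\<close> with entries in a fixed vertex set
  \<open>A\<close>, with lists of length 0 included: then vertices can be split off and prepended without
  asking which sets are simplices, and inductions over lists go through.\<close>

definition simplex_chains :: "'a set \<Rightarrow> nat \<Rightarrow> ('a, 'k::field) chain set" where
  "simplex_chains A m = chains.span (simplex_chain ` {xs. length xs = m \<and> set xs \<subseteq> A})"

definition relation_gens :: "'a set \<Rightarrow> nat \<Rightarrow> ('a, 'k::field) chain set" where
  "relation_gens A m =
     {simplex_chain (us @ [a, b] @ vs) + simplex_chain (us @ [b, a] @ vs)
         | us a b vs. length (us @ [a, b] @ vs) = m \<and> set (us @ [a, b] @ vs) \<subseteq> A} \<union>
     {simplex_chain (us @ [a, a] @ vs)
         | us a vs. length (us @ [a, a] @ vs) = m \<and> set (us @ [a, a] @ vs) \<subseteq> A}"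

definition relations :: "'a set \<Rightarrow> nat \<Rightarrow> ('a, 'k::field) chain set" where
  "relations A m = chains.span (relation_gens A m)"

lemma subspace_relations [simp, intro]: "chains.subspace (relations A m)"
  by (simp add: relations_def)

lemma subspace_simplex_chains [simp, intro]: "chains.subspace (simplex_chains A m)"
  by (simp add: simplex_chains_def)

lemmas relations_add = chains.subspace_add[OF subspace_relations]
  and relations_diff = chains.subspace_diff[OF subspace_relations]
  and relations_0 [simp, intro] = chains.subspace_0[OF subspace_relations]

lemmas simplex_chains_add = chains.subspace_add[OF subspace_simplex_chains]
  and simplex_chains_diff = chains.subspace_diff[OF subspace_simplex_chains]
  and simplex_chains_0 [simp, intro] = chains.subspace_0[OF subspace_simplex_chains]

lemma relations_swap:
  assumes "length us + length vs + 2 = m" and "insert a (insert b (set us \<union> set vs)) \<subseteq> A"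
  shows "simplex_chain (us @ a # b # vs) + simplex_chain (us @ b # a # vs) \<in> relations A m"
  unfolding relations_def relation_gens_def
  by (intro chains.span_base UnI1 CollectI exI[of _ us] exI[of _ a] exI[of _ b] exI[of _ vs]) (use assms in auto)

lemma relations_repeat:
  assumes "length us + length vs + 2 = m" and "insert a (set us \<union> set vs) \<subseteq> A"
  shows "simplex_chain (us @ a # a # vs) \<in> relations A m"
  unfolding relations_def relation_gens_def
  by (intro chains.span_base UnI2 CollectI exI[of _ us] exI[of _ a] exI[of _ vs]) (use assms in auto)

lemma relations_mem:
  fixes T :: "('a, 'k::field) chain \<Rightarrow> ('b, 'k) chain"
  assumes T: "chain_hom T" and W: "chains.subspace W"
    and "\<And>us a b vs. length us + length vs + 2 = m \<Longrightarrow> set us \<subseteq> A \<Longrightarrow> a \<in> A \<Longrightarrow> b \<in> A \<Longrightarrow> set vs \<subseteq> A \<Longrightarrow>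
      T (simplex_chain (us @ a # b # vs) + simplex_chain (us @ b # a # vs)) \<in> W"
    and "\<And>us a vs. length us + length vs + 2 = m \<Longrightarrow> set us \<subseteq> A \<Longrightarrow> a \<in> A \<Longrightarrow> set vs \<subseteq> A \<Longrightarrow>
      T (simplex_chain (us @ a # a # vs)) \<in> W"
    and c: "c \<in> relations A m"
  shows "T c \<in> W"
proof (rule chain_hom_span_mem[OF T W _ c[unfolded relations_def]])
  fix x :: "('a, 'k) chain"
  assume "x \<in> relation_gens A m"
  then show "T x \<in> W"
    unfolding relation_gens_def by (elim UnE CollectE exE conjE) (simp_all add: assms(3,4))
qed

lemma simplex_chains_base: "length xs = m \<Longrightarrow> set xs \<subseteq> A \<Longrightarrow> simplex_chain xs \<in> simplex_chains A m"
  unfolding simplex_chains_def by (rule chains.span_base) auto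

lemma simplex_chains_mem:
  fixes T :: "('a, 'k::field) chain \<Rightarrow> ('b, 'k) chain"
  assumes T: "chain_hom T" and W: "chains.subspace W"
    and "\<And>xs. length xs = m \<Longrightarrow> set xs \<subseteq> A \<Longrightarrow> T (simplex_chain xs) \<in> W"
    and c: "c \<in> simplex_chains A m"
  shows "T c \<in> W"
  by (rule chain_hom_span_mem[OF T W _ c[unfolded simplex_chains_def]]) (use assms(3) in auto)

lemma prepend_simplex_chains: "x \<in> A \<Longrightarrow> c \<in> simplex_chains A m \<Longrightarrow> prepend x c \<in> simplex_chains A (Suc m)"
  by (rule simplex_chains_mem[of "prepend x"]) (auto intro!: simplex_chains_base)

lemma prepend_relations:
  assumes x: "x \<in> A" and c: "c \<in> relations A m"
  shows "prepend x c \<in> relations A (Suc m)"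
proof (rule relations_mem[OF _ _ _ _ c])
  fix us a b vs
  assume "length us + length vs + 2 = m" "set us \<subseteq> A" "a \<in> A" "b \<in> A" "set vs \<subseteq> A"
  then show "prepend x (simplex_chain (us @ a # b # vs) + simplex_chain (us @ b # a # vs)) \<in> relations A (Suc m)"
    using x relations_swap[of "x # us" vs "Suc m" a b A] by simp
next
  fix us a vs
  assume "length us + length vs + 2 = m" "set us \<subseteq> A" "a \<in> A" "set vs \<subseteq> A"
  then show "prepend x (simplex_chain (us @ a # a # vs)) \<in> relations A (Suc m)"
    using x relations_repeat[of "x # us" vs "Suc m" a A] by simp
qed auto

text \<open>The relations of \<open>orientation_relations\<close> impose a sign change for adjacent vertices in arbitrary
  position; at the front they hold for a whole chain of tails at once.\<close>

lemma prepend_prepend_swap: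
  assumes "x \<in> A" "y \<in> A" "c \<in> simplex_chains A m"
  shows "prepend x (prepend y c) + prepend y (prepend x c) \<in> relations A (m + 2)"
proof (rule simplex_chains_mem[where T = "\<lambda>c. prepend x (prepend y c) + prepend y (prepend x c)", OF _ _ _ assms(3)])
  fix xs assume "length xs = m" "set xs \<subseteq> A"
  then show "prepend x (prepend y (simplex_chain xs)) + prepend y (prepend x (simplex_chain xs)) \<in> relations A (m + 2)"
    using assms relations_swap[of "[]" xs "m + 2" x y A] by simp
qed (auto intro!: chain_hom_intros)

lemma prepend_prepend_repeat:
  assumes "x \<in> A" "c \<in> simplex_chains A m"
  shows "prepend x (prepend x c) \<in> relations A (m + 2)"
proof (rule simplex_chains_mem[where T = "\<lambda>c. prepend x (prepend x c)", OF _ _ _ assms(2)])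
  fix xs assume "length xs = m" "set xs \<subseteq> A"
  then show "prepend x (prepend x (simplex_chain xs)) \<in> relations A (m + 2)"
    using assms relations_repeat[of "[]" xs "m + 2" x A] by simp
qed (auto intro!: chain_hom_intros)

text \<open>Moving one of two equal vertices next to the other changes the simplex only by a sign modulo
  relations, and a simplex with an adjacent repetition is a relation.\<close>

lemma relations_not_distinct:
  assumes "\<not> distinct xs" and "length xs = m" and "set xs \<subseteq> A"
  shows "(simplex_chain xs :: ('a, 'k::field) chain) \<in> relations A m"
proof -
  have *: "(simplex_chain (us @ y # ys @ y # zs) :: ('a, 'k) chain) \<in> relations A m"
    if "length us + length ys + length zs + 2 = m" and "insert y (set us \<union> set ys \<union> set zs) \<subseteq> A" for us y ys zs
    using that
  proof (induction ys arbitrary: us)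
    case Nil
    then show ?case using relations_repeat[of us zs m y A] by simp
  next
    case (Cons z ys)
    let ?c = "simplex_chain (us @ y # z # ys @ y # zs) :: ('a, 'k) chain"
    let ?c' = "simplex_chain (us @ z # y # ys @ y # zs) :: ('a, 'k) chain"
    have "?c + ?c' \<in> relations A m"
      using Cons.prems by (intro relations_swap) auto
    moreover have "?c' \<in> relations A m"
      using Cons.prems Cons.IH[of "us @ [z]"] by simp
    ultimately have "?c + ?c' - ?c' \<in> relations A m"
      by (intro relations_diff)
    then show ?case by simp
  qed
  obtain us ys zs y where "xs = us @ [y] @ ys @ [y] @ zs"
    using not_distinct_decomp[OF assms(1)] by blast
  then show ?thesis using *[of us ys zs y] assms by simp
qed

lemma bd_simplex_chains:
  assumes "c \<in> simplex_chains A (Suc m)"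
  shows "bd c \<in> simplex_chains A m"
proof (rule simplex_chains_mem[OF _ _ _ assms])
  fix xs :: "'a list"
  assume "length xs = Suc m" "set xs \<subseteq> A"
  then show "bd (simplex_chain xs) \<in> (simplex_chains A m :: ('a, 'b) chain set)"
  proof (induction xs arbitrary: m)
    case (Cons x xs)
    have "prepend x (boundary_simplex xs) \<in> (simplex_chains A m :: ('a, 'b) chain set)"
    proof (cases m)
      case 0
      then show ?thesis using Cons.prems by simp
    next
      case (Suc k)
      then show ?thesis using Cons.IH[of k] Cons.prems by (simp add: prepend_simplex_chains)
    qed
    moreover have "simplex_chain xs \<in> (simplex_chains A m :: ('a, 'b) chain set)"
      using Cons.prems by (intro simplex_chains_base) auto
    ultimately show ?case by (simp add: simplex_chains_diff)
  qed simp
qed auto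

text \<open>Prefixes are split off with \<open>bd_prepend\<close>, which leaves the case of a relation in the first two
  vertices. There the two faces that omit one of these vertices cancel, and the other faces
  still carry the relation at the front.\<close>

lemma bd_relations:
  fixes c :: "('a, 'k::field) chain"
  assumes "c \<in> relations A (Suc m)"
  shows "bd c \<in> relations A m"
proof (rule relations_mem[OF _ _ _ _ assms])
  fix us vs :: "'a list" and a b
  let ?c = "\<lambda>us. simplex_chain (us @ a # b # vs) + simplex_chain (us @ b # a # vs) :: ('a, 'k) chain"
  assume "length us + length vs + 2 = Suc m" "set us \<subseteq> A" "a \<in> A" "b \<in> A" "set vs \<subseteq> A"
  then show "bd (?c us) \<in> relations A m"
  proof (induction us arbitrary: m)
    case Nil
    have "bd (?c []) = prepend a (prepend b (bd (simplex_chain vs))) + prepend b (prepend a (bd (simplex_chain vs)))"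
      by (simp add: algebra_simps)
    also have "\<dots> \<in> relations A m"
    proof (cases vs)
      case (Cons v vs')
      have "bd (simplex_chain vs) \<in> (simplex_chains A (length vs') :: ('a, 'k) chain set)"
        by (rule bd_simplex_chains, rule simplex_chains_base) (use Nil Cons in auto)
      then show ?thesis
        using prepend_prepend_swap[of a A b "bd (simplex_chain vs)" "length vs'"] Nil Cons by simp
    qed simp
    finally show ?case .
  next
    case (Cons u us)
    obtain k where k: "m = Suc k" using Cons.prems by (cases m) auto
    have "bd (?c (u # us)) = ?c us - prepend u (bd (?c us))"
      by (subst bd_prepend[symmetric]) simp
    also have "\<dots> \<in> relations A m"
    proof (rule relations_diff)
      show "?c us \<in> relations A m" using Cons.prems by (intro relations_swap) auto
      show "prepend u (bd (?c us)) \<in> relations A m"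
        unfolding k using Cons.prems k by (intro prepend_relations Cons.IH) auto
    qed
    finally show ?case .
  qed
next
  fix us vs :: "'a list" and a
  let ?c = "\<lambda>us. simplex_chain (us @ a # a # vs) :: ('a, 'k) chain"
  assume "length us + length vs + 2 = Suc m" "set us \<subseteq> A" "a \<in> A" "set vs \<subseteq> A"
  then show "bd (?c us) \<in> relations A m"
  proof (induction us arbitrary: m)
    case Nil
    have "bd (?c []) = prepend a (prepend a (bd (simplex_chain vs)))"
      by (simp add: algebra_simps)
    also have "\<dots> \<in> relations A m"
    proof (cases vs)
      case (Cons v vs')
      have "bd (simplex_chain vs) \<in> (simplex_chains A (length vs') :: ('a, 'k) chain set)"
        by (rule bd_simplex_chains, rule simplex_chains_base) (use Nil Cons in auto)
      then show ?thesis
        using prepend_prepend_repeat[of a A "bd (simplex_chain vs)" "length vs'"] Nil Cons by simp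
    qed simp
    finally show ?case .
  next
    case (Cons u us)
    obtain k where k: "m = Suc k" using Cons.prems by (cases m) auto
    have "bd (?c (u # us)) = ?c us - prepend u (bd (?c us))"
      by (subst bd_prepend[symmetric]) simp
    also have "\<dots> \<in> relations A m"
    proof (rule relations_diff)
      show "?c us \<in> relations A m" using Cons.prems by (intro relations_repeat) auto
      show "prepend u (bd (?c us)) \<in> relations A m"
        unfolding k using Cons.prems k by (intro prepend_relations Cons.IH) auto
    qed
    finally show ?case .
  qed
qed auto

lemma push_simplex_chains:
  assumes "c \<in> simplex_chains A m" and "f ` A \<subseteq> B"
  shows "push f c \<in> simplex_chains B m"
  by (rule simplex_chains_mem[OF _ _ _ assms(1)]) (use assms(2) in \<open>auto simp: image_subset_iff subset_iff intro!: simplex_chains_base\<close>)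

lemma push_relations:
  assumes "c \<in> relations A m" and "f ` A \<subseteq> B"
  shows "push f c \<in> relations B m"
proof (rule relations_mem[OF _ _ _ _ assms(1)])
  fix us a b vs
  assume "length us + length vs + 2 = m" "set us \<subseteq> A" "a \<in> A" "b \<in> A" "set vs \<subseteq> A"
  then show "push f (simplex_chain (us @ a # b # vs) + simplex_chain (us @ b # a # vs)) \<in> relations B m"
    using assms(2) relations_swap[of "map f us" "map f vs" m "f a" "f b" B] by auto
next
  fix us a vs
  assume "length us + length vs + 2 = m" "set us \<subseteq> A" "a \<in> A" "set vs \<subseteq> A"
  then show "push f (simplex_chain (us @ a # a # vs)) \<in> relations B m"
    using assms(2) relations_repeat[of "map f us" "map f vs" m "f a" B] by auto
qed auto

lemma homotopy_simplex_chains: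
  fixes c :: "('a, 'k::field) chain"
  assumes "c \<in> simplex_chains A m" and B: "f ` A \<subseteq> B" and w: "v \<in> A \<Longrightarrow> w \<in> B"
  shows "homotopy f v w c \<in> simplex_chains B (Suc m)"
proof (rule simplex_chains_mem[OF _ _ _ assms(1)])
  fix xs assume "length xs = m" "set xs \<subseteq> A"
  then show "homotopy f v w (simplex_chain xs :: ('a, 'k) chain) \<in> simplex_chains B (Suc m)"
  proof (induction xs arbitrary: m)
    case (Cons x xs)
    have "prepend (f x) (prism f v w xs) \<in> (simplex_chains B (Suc m) :: ('b, 'k) chain set)"
      using Cons B by (cases m) (auto intro!: prepend_simplex_chains)
    moreover have "(if x = v then simplex_chain (f v # w # map f xs) else 0)
        \<in> (simplex_chains B (Suc m) :: ('b, 'k) chain set)"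
      using Cons.prems B w by (auto simp: image_subset_iff subset_iff intro!: simplex_chains_base)
    ultimately show ?case by (simp only: on_simplex_chain prism.simps simplex_chains_diff)
  qed simp
qed auto

text \<open>In exterior notation, \<open>x \<and> w \<and> y = y \<and> x \<and> w\<close>: the vertex \<open>y\<close> passes two others. This holds for
  \<open>x = y\<close> as well, which is what a repeated vertex needs in every characteristic.\<close>

lemma prepend3_swap:
  assumes "x \<in> A" "y \<in> A" "w \<in> A" "c \<in> simplex_chains A m"
  shows "prepend x (prepend w (prepend y c)) - prepend y (prepend x (prepend w c)) \<in> relations A (m + 3)"
proof -
  have "prepend x (prepend w (prepend y c) + prepend y (prepend w c)) \<in> relations A (Suc (m + 2))"
    using assms by (intro prepend_relations prepend_prepend_swap)
  moreover have "prepend x (prepend y (prepend w c)) + prepend y (prepend x (prepend w c)) \<in> relations A (Suc m + 2)"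
    using assms by (intro prepend_prepend_swap prepend_simplex_chains)
  ultimately have "prepend x (prepend w (prepend y c) + prepend y (prepend w c)) -
     (prepend x (prepend y (prepend w c)) + prepend y (prepend x (prepend w c))) \<in> relations A (m + 3)"
    by (intro relations_diff) (simp_all add: numeral_3_eq_3)
  then show ?thesis by simp
qed

text \<open>The homotopy \<open>f v \<and> w \<and> f\<^sub>*(\<iota>\<^sub>v \<omega>)\<close> is alternating in \<open>\<omega>\<close>. Concretely, a common prefix is split off
  with \<open>homotopy_prepend\<close>; for a relation in the first two vertices \<open>a\<close> and \<open>b\<close> the terms that do
  not see \<open>v\<close> there form a relation, and those from \<open>a = v\<close> or \<open>b = v\<close> pair up as in
  \<open>prepend3_swap\<close>.\<close>

lemma homotopy_relations:
  fixes c :: "('a, 'k::field) chain"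
  assumes "c \<in> relations A m" and B: "f ` A \<subseteq> B" and w: "v \<in> A \<Longrightarrow> w \<in> B"
  shows "homotopy f v w c \<in> relations B (Suc m)"
proof -
  have step: "homotopy f v w (prepend u c) \<in> relations B (Suc (Suc k))"
    if c: "c \<in> relations A k" "homotopy f v w c \<in> relations B (Suc k)" and u: "u \<in> A" for u k and c :: "('a, 'k) chain"
  proof -
    have "prepend (f u) (homotopy f v w c) \<in> relations B (Suc (Suc k))"
      using u B c by (intro prepend_relations) auto
    moreover have "(if u = v then prepend (f v) (prepend w (push f c)) else 0) \<in> relations B (Suc (Suc k))"
      using u B w by (auto intro!: prepend_relations push_relations[OF c(1)])
    ultimately show ?thesis unfolding homotopy_prepend by (rule relations_diff[rotated])
  qed
  have pc: "push f (simplex_chain vs) \<in> (simplex_chains B (length vs) :: ('b, 'k) chain set)"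
    and hc: "homotopy f v w (simplex_chain vs) \<in> (simplex_chains B (Suc (length vs)) :: ('b, 'k) chain set)"
    if "set vs \<subseteq> A" for vs
    using push_simplex_chains[OF simplex_chains_base[OF refl that] B]
      homotopy_simplex_chains[OF simplex_chains_base[OF refl that] B w] by blast+
  have swap: "homotopy f v w (simplex_chain (us @ a # b # vs) + simplex_chain (us @ b # a # vs) :: ('a, 'k) chain)
      \<in> relations B (Suc m)"
    if "length us + length vs + 2 = m" "set us \<subseteq> A" "a \<in> A" "b \<in> A" "set vs \<subseteq> A" for us a b vs
  proof -
    let ?c = "\<lambda>us. simplex_chain (us @ a # b # vs) + simplex_chain (us @ b # a # vs) :: ('a, 'k) chain"
    from that have "homotopy f v w (?c us) \<in> relations B (Suc m)"
    proof (induction us arbitrary: m)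
      case Nil
      let ?p = "push f (simplex_chain vs) :: ('b, 'k) chain" and ?h = "homotopy f v w (simplex_chain vs) :: ('b, 'k) chain"
      have [simp]: "Suc (length vs + 2) = Suc m" using Nil by simp
      have "homotopy f v w (?c []) = (prepend (f a) (prepend (f b) ?h) + prepend (f b) (prepend (f a) ?h))
          + (if a = v then prepend (f a) (prepend w (prepend (f b) ?p)) - prepend (f b) (prepend (f a) (prepend w ?p)) else 0)
          + (if b = v then prepend (f b) (prepend w (prepend (f a) ?p)) - prepend (f a) (prepend (f b) (prepend w ?p)) else 0)"
        by (simp add: algebra_simps)
      also have "\<dots> \<in> relations B (Suc m)"
      proof (rule relations_add[OF relations_add])
        show "prepend (f a) (prepend (f b) ?h) + prepend (f b) (prepend (f a) ?h) \<in> relations B (Suc m)"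
          using prepend_prepend_swap[of "f a" B "f b" ?h "Suc (length vs)"] hc Nil B by auto
        show "(if a = v then prepend (f a) (prepend w (prepend (f b) ?p)) - prepend (f b) (prepend (f a) (prepend w ?p)) else 0)
            \<in> relations B (Suc m)"
          using prepend3_swap[of "f a" B "f b" w ?p "length vs"] pc Nil B w by (auto simp: numeral_3_eq_3)
        show "(if b = v then prepend (f b) (prepend w (prepend (f a) ?p)) - prepend (f a) (prepend (f b) (prepend w ?p)) else 0)
            \<in> relations B (Suc m)"
          using prepend3_swap[of "f b" B "f a" w ?p "length vs"] pc Nil B w by (auto simp: numeral_3_eq_3)
      qed
      finally show ?case .
    next
      case (Cons u us)
      obtain k where k: "m = Suc k" using Cons.prems by (cases m) auto
      have "homotopy f v w (prepend u (?c us)) \<in> relations B (Suc (Suc k))"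
        using Cons.prems k by (intro step Cons.IH relations_swap) auto
      then show ?case by (simp add: k)
    qed
    then show ?thesis .
  qed
  have repeat: "homotopy f v w (simplex_chain (us @ a # a # vs) :: ('a, 'k) chain) \<in> relations B (Suc m)"
    if "length us + length vs + 2 = m" "set us \<subseteq> A" "a \<in> A" "set vs \<subseteq> A" for us a vs
    using that
  proof (induction us arbitrary: m)
    case Nil
    let ?p = "push f (simplex_chain vs) :: ('b, 'k) chain" and ?h = "homotopy f v w (simplex_chain vs) :: ('b, 'k) chain"
    have "homotopy f v w (simplex_chain (a # a # vs)) = prepend (f a) (prepend (f a) ?h)
        + (if a = v then prepend (f a) (prepend w (prepend (f a) ?p)) - prepend (f a) (prepend (f a) (prepend w ?p)) else 0)"
      by (simp add: algebra_simps)
    also have "\<dots> \<in> relations B (Suc m)"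
    proof (intro relations_add)
      show "prepend (f a) (prepend (f a) ?h) \<in> relations B (Suc m)"
        using prepend_prepend_repeat[of "f a" B ?h "Suc (length vs)"] hc Nil B by auto
      show "(if a = v then prepend (f a) (prepend w (prepend (f a) ?p)) - prepend (f a) (prepend (f a) (prepend w ?p)) else 0)
          \<in> relations B (Suc m)"
        using prepend3_swap[of "f a" B "f a" w ?p "length vs"] pc Nil B w by (auto simp: numeral_3_eq_3)
    qed
    finally show ?case by simp
  next
    case (Cons u us)
    obtain k where k: "m = Suc k" using Cons.prems by (cases m) auto
    have "homotopy f v w (prepend u (simplex_chain (us @ a # a # vs) :: ('a, 'k) chain)) \<in> relations B (Suc (Suc k))"
      using Cons.prems k by (intro step Cons.IH relations_repeat) auto
    then show ?case by (simp add: k)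
  qed
  show ?thesis
    by (rule relations_mem[OF _ _ swap repeat assms(1)]) auto
qed

text \<open>On a list with a repeated vertex the exact identity fails, but every term is then a relation,
  because all operators involved preserve relations.\<close>

lemma prism_homotopy_mod_relations:
  fixes xs :: "'a list" and w :: 'b
  assumes "length xs = m" "set xs \<subseteq> A" and B: "f ` A \<subseteq> B" and w: "v \<in> A \<Longrightarrow> w \<in> B"
  defines "c \<equiv> simplex_chain xs :: ('a, 'k::field) chain"
  shows "bd (homotopy f v w c) + homotopy f v w (bd c) - (push (f(v := w)) c - push f c) \<in> relations B m"
proof (cases "distinct xs")
  case True
  then show ?thesis
    unfolding c_def by (simp only: on_simplex_chain prism_homotopy diff_self relations_0)
next
  case False
  then obtain k where k: "m = Suc k" using assms(1) by (cases xs) auto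
  have c: "c \<in> relations A m" unfolding c_def using False assms by (intro relations_not_distinct)
  have "homotopy f v w (bd c) \<in> relations B m"
    unfolding k using c k B w by (intro homotopy_relations bd_relations) auto
  moreover have "bd (homotopy f v w c) \<in> relations B m"
    using c B w by (intro bd_relations homotopy_relations) auto
  moreover have "push f c \<in> relations B m" "push (f(v := w)) c \<in> relations B m"
    using B w by (auto simp: image_subset_iff intro!: push_relations[OF c])
  ultimately show ?thesis by (intro relations_add relations_diff)
qed

section \<open>Contiguous maps\<close>

definition simplicial_complex :: "'a set set \<Rightarrow> bool" where
  "simplicial_complex K \<longleftrightarrow> {} \<notin> K \<and> (\<forall>A\<in>K. \<forall>B\<subseteq>A. B \<noteq> {} \<longrightarrow> B \<in> K)"

definition simplicial_map :: "('a \<Rightarrow> 'b) \<Rightarrow> 'a set set \<Rightarrow> 'b set set \<Rightarrow> bool" where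
  "simplicial_map f K L \<longleftrightarrow> (\<forall>A\<in>K. f ` A \<in> L)"

definition contiguous :: "('a \<Rightarrow> 'b) \<Rightarrow> ('a \<Rightarrow> 'b) \<Rightarrow> 'a set set \<Rightarrow> 'b set set \<Rightarrow> bool" where
  "contiguous f g K L \<longleftrightarrow> (\<forall>A\<in>K. f ` A \<union> g ` A \<in> L)"

definition chain_space :: "nat \<Rightarrow> 'a set set \<Rightarrow> ('a, 'k::field) chain set" where
  "chain_space n K = {c. Poly_Mapping.keys c \<subseteq> ordered_simplices n K}"

lemma subspace_chain_space [simp, intro]:
  "chains.subspace (chain_space n K :: ('a, 'k::field) chain set)"
proof (rule chains.subspaceI)
  fix c c' :: "('a, 'k) chain"
  assume "c \<in> chain_space n K" "c' \<in> chain_space n K"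
  then show "c + c' \<in> chain_space n K"
    using Poly_Mapping.keys_add[of c c'] by (auto simp: chain_space_def)
qed (auto simp: chain_space_def in_keys_iff subset_iff)

lemma subspace_orientation_relations [simp, intro]: "chains.subspace (orientation_relations n K)"
  by (simp add: orientation_relations_def)

lemma chain_space_mem:
  fixes T :: "('a, 'k::field) chain \<Rightarrow> ('b, 'k) chain"
  assumes "chain_hom T" and "chains.subspace W"
    and "\<And>xs. length xs = Suc n \<Longrightarrow> set xs \<in> K \<Longrightarrow> T (simplex_chain xs) \<in> W"
    and "c \<in> chain_space n K"
  shows "T c \<in> W"
  by (rule chain_hom_mem[OF assms(1,2)]) (use assms(3,4) in \<open>auto simp: chain_space_def ordered_simplices_def\<close>)

lemma chain_space_base: "length xs = Suc n \<Longrightarrow> set xs \<in> K \<Longrightarrow> simplex_chain xs \<in> chain_space n K"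
  by (auto simp: chain_space_def ordered_simplices_def)

lemma simplex_chains_subset_chain_space:
  assumes "simplicial_complex K" and "A \<in> K"
  shows "simplex_chains A (Suc n) \<subseteq> chain_space n K"
  unfolding simplex_chains_def
proof (rule chains.span_minimal)
  have "set xs \<in> K" if "length xs = Suc n" "set xs \<subseteq> A" for xs
    using assms that unfolding simplicial_complex_def by (metis list.size(3) nat.distinct(1) set_empty)
  then show "simplex_chain ` {xs. length xs = Suc n \<and> set xs \<subseteq> A} \<subseteq> chain_space n K"
    by (auto intro!: chain_space_base)
qed simp

lemma relations_subset_orientation_relations:
  assumes "simplicial_complex K" and "A \<in> K"
  shows "relations A (Suc n) \<subseteq> orientation_relations n K"
  unfolding relations_def orientation_relations_def
proof (rule chains.span_mono)
  have K: "set xs \<in> K" if "length xs = Suc n" "set xs \<subseteq> A" for xs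
    using assms that unfolding simplicial_complex_def by (metis list.size(3) nat.distinct(1) set_empty)
  show "relation_gens A (Suc n) \<subseteq>
      {simplex_chain (us @ [a, b] @ vs) + simplex_chain (us @ [b, a] @ vs)
         | us a b vs. us @ [a, b] @ vs \<in> ordered_simplices n K} \<union>
      {simplex_chain (us @ [a, a] @ vs) | us a vs. us @ [a, a] @ vs \<in> ordered_simplices n K}"
    unfolding relation_gens_def ordered_simplices_def
    by (intro Un_mono Collect_mono impI; elim exE conjE; intro exI conjI CollectI; (rule K)?; assumption?; simp?)
qed

text \<open>Together with \<open>relations_subset_orientation_relations\<close> this identifies the relations of a complex
  as those generated by its individual simplices, and reduces each claim about them to one simplex.\<close>

lemma orientation_relations_mem:
  fixes T :: "('a, 'k::field) chain \<Rightarrow> ('b, 'k) chain"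
  assumes T: "chain_hom T" and W: "chains.subspace W"
    and mem: "\<And>A c. A \<in> K \<Longrightarrow> c \<in> relations A (Suc n) \<Longrightarrow> T c \<in> W"
    and "c \<in> orientation_relations n K"
  shows "T c \<in> W"
proof (rule chain_hom_span_mem[OF T W _ assms(4)[unfolded orientation_relations_def]])
  fix x :: "('a, 'k) chain"
  assume "x \<in> {simplex_chain (us @ [a, b] @ vs) + simplex_chain (us @ [b, a] @ vs)
         | us a b vs. us @ [a, b] @ vs \<in> ordered_simplices n K} \<union>
      {simplex_chain (us @ [a, a] @ vs) | us a vs. us @ [a, a] @ vs \<in> ordered_simplices n K}"
  then have "\<exists>A\<in>K. x \<in> relations A (Suc n)"
  proof (elim UnE CollectE exE conjE)
    fix us a b vs
    assume "x = simplex_chain (us @ [a, b] @ vs) + simplex_chain (us @ [b, a] @ vs)"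
      and "us @ [a, b] @ vs \<in> ordered_simplices n K"
    then show ?thesis
      by (intro bexI[of _ "set (us @ [a, b] @ vs)"]) (auto simp: ordered_simplices_def intro!: relations_swap)
  next
    fix us a vs
    assume "x = simplex_chain (us @ [a, a] @ vs)" and "us @ [a, a] @ vs \<in> ordered_simplices n K"
    then show ?thesis
      by (intro bexI[of _ "set (us @ [a, a] @ vs)"]) (auto simp: ordered_simplices_def intro!: relations_repeat)
  qed
  then show "T x \<in> W" using mem by blast
qed

lemma relations_subset_simplex_chains: "relations A m \<subseteq> simplex_chains A m"
  unfolding relations_def
proof (rule chains.span_minimal)
  show "relation_gens A m \<subseteq> simplex_chains A m"
    unfolding relation_gens_def by (auto intro!: simplex_chains_add simplex_chains_base)
qed simp

lemma orientation_relations_subset: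
  assumes "simplicial_complex K"
  shows "orientation_relations n K \<subseteq> chain_space n K"
proof
  fix c :: "('a, 'k::field) chain" assume "c \<in> orientation_relations n K"
  then show "c \<in> chain_space n K"
    by (rule orientation_relations_mem[OF chains.module_hom_ident, rotated -1])
       (use relations_subset_simplex_chains simplex_chains_subset_chain_space[OF assms] in \<open>blast+\<close>)
qed

lemma bd_chain_space:
  assumes K: "simplicial_complex K" and "c \<in> chain_space (Suc n) K"
  shows "bd c \<in> chain_space n K"
  by (rule chain_space_mem[OF _ _ _ assms(2)])
     (use simplex_chains_subset_chain_space[OF K] in \<open>blast intro: bd_simplex_chains simplex_chains_base\<close>)+

lemma bd_orientation_relations:
  assumes K: "simplicial_complex K" and "c \<in> orientation_relations (Suc n) K"
  shows "bd c \<in> orientation_relations n K"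
  by (rule orientation_relations_mem[OF _ _ _ assms(2)])
     (use relations_subset_orientation_relations[OF K] in \<open>blast intro: bd_relations\<close>)+

lemma push_chain_space:
  assumes "simplicial_map f K L" and "c \<in> chain_space n K"
  shows "push f c \<in> chain_space n L"
  by (rule chain_space_mem[OF _ _ _ assms(2)])
     (use assms(1) in \<open>auto simp: simplicial_map_def intro!: chain_space_base\<close>)

lemma push_orientation_relations:
  fixes c :: "('a, 'k::field) chain"
  assumes L: "simplicial_complex L" and "simplicial_map f K L" and "c \<in> orientation_relations n K"
  shows "push f c \<in> orientation_relations n L"
proof (rule orientation_relations_mem[OF _ _ _ assms(3)])
  fix A and c :: "('a, 'k) chain"
  assume "A \<in> K" "c \<in> relations A (Suc n)"
  then have "push f c \<in> relations (f ` A) (Suc n)" "f ` A \<in> L"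
    using assms(2) by (auto simp: simplicial_map_def intro: push_relations)
  then show "push f c \<in> orientation_relations n L"
    using relations_subset_orientation_relations[OF L] by blast
qed auto

text \<open>Representatives, among ordered chains, of oriented cycles and boundaries. As for \<open>cycles\<close>, every
  chain of degree 0 counts.\<close>

definition chain_cycles :: "nat \<Rightarrow> 'a set set \<Rightarrow> ('a, 'k::field) chain set" where
  "chain_cycles n K =
     {c \<in> chain_space n K. \<forall>m. n = Suc m \<longrightarrow> bd c \<in> orientation_relations m K}"

definition chain_boundaries :: "nat \<Rightarrow> 'a set set \<Rightarrow> ('a, 'k::field) chain set" where
  "chain_boundaries n K =
     {r + bd b | r b. r \<in> orientation_relations n K \<and> b \<in> chain_space (Suc n) K}"

lemma chain_boundaries_0 [simp]: "0 \<in> chain_boundaries n K"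
proof -
  have "(0 :: ('a, 'b) chain) = 0 + bd 0" by simp
  then show ?thesis
    unfolding chain_boundaries_def
    using chains.subspace_0[OF subspace_chain_space] chains.subspace_0[OF subspace_orientation_relations] by blast
qed

lemma chain_boundaries_add:
  assumes "c \<in> chain_boundaries n K" "c' \<in> chain_boundaries n K"
  shows "c + c' \<in> chain_boundaries n K"
proof -
  obtain r b r' b' where *: "c = r + bd b" "c' = r' + bd b'"
    "r \<in> orientation_relations n K" "b \<in> chain_space (Suc n) K"
    "r' \<in> orientation_relations n K" "b' \<in> chain_space (Suc n) K"
    using assms unfolding chain_boundaries_def by blast
  then have "c + c' = (r + r') + bd (b + b')" by simp
  then show ?thesis
    unfolding chain_boundaries_def
    using chains.subspace_add[OF subspace_chain_space] chains.subspace_add[OF subspace_orientation_relations] * by blast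
qed

lemma push_chain_cycles:
  assumes "simplicial_complex L" and "simplicial_map f K L" and "c \<in> chain_cycles n K"
  shows "push f c \<in> chain_cycles n L"
  using assms push_orientation_relations[OF assms(1,2)]
  by (auto simp: chain_cycles_def push_chain_space push_bd[symmetric])

text \<open>The homotopy formula holds modulo relations in each simplex of the target that has room for the
  old and the new position of \<open>v\<close>. The boundary of a cycle is a relation, so the term
  \<open>homotopy f v w (bd c)\<close> is one too, and the difference is a boundary. In degree 0 that term
  vanishes outright, since \<open>bd c\<close> is a multiple of the empty list.\<close>

lemma move_one_vertex:
  fixes c :: "('a, 'k::field) chain"
  assumes L: "simplicial_complex L"
    and room: "\<And>A. A \<in> K \<Longrightarrow> \<exists>B\<in>L. f ` A \<subseteq> B \<and> (v \<in> A \<longrightarrow> w \<in> B)"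
    and c: "c \<in> chain_cycles n K"
  shows "push (f(v := w)) c - push f c \<in> chain_boundaries n L"
proof -
  let ?E = "\<lambda>c :: ('a, 'k) chain. bd (homotopy f v w c) + homotopy f v w (bd c) - (push (f(v := w)) c - push f c)"
  have cK: "c \<in> chain_space n K" using c by (simp add: chain_cycles_def)
  have "?E c \<in> orientation_relations n L"
  proof (rule chain_space_mem[OF _ _ _ cK])
    fix xs assume xs: "length xs = Suc n" "set xs \<in> K"
    then obtain B where "B \<in> L" "f ` set xs \<subseteq> B" "v \<in> set xs \<longrightarrow> w \<in> B" using room by blast
    then show "?E (simplex_chain xs) \<in> orientation_relations n L"
      using prism_homotopy_mod_relations[OF xs(1) order_refl, of f B v w] relations_subset_orientation_relations[OF L, of B n]
      by blast
  qed (auto intro!: chain_hom_intros)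
  moreover have "homotopy f v w (bd c) \<in> orientation_relations n L"
  proof (cases n)
    case 0
    have "homotopy f v w (bd c) \<in> {0}"
    proof (rule chain_space_mem[OF _ _ _ cK])
      fix xs :: "'a list" assume "length xs = Suc n"
      then obtain x where "xs = [x]" using 0 by (cases xs) auto
      then show "homotopy f v w (bd (simplex_chain xs)) \<in> {0 :: ('b, 'k) chain}" by simp
    qed (auto intro!: chain_hom_intros)
    then show ?thesis using chains.subspace_0[OF subspace_orientation_relations] by simp
  next
    case (Suc m)
    then have "bd c \<in> orientation_relations m K" using c by (simp add: chain_cycles_def)
    then show ?thesis
    proof (rule orientation_relations_mem[rotated -1])
      fix A and c :: "('a, 'k) chain" assume A: "A \<in> K" "c \<in> relations A (Suc m)"
      then obtain B where "B \<in> L" "f ` A \<subseteq> B" "v \<in> A \<longrightarrow> w \<in> B" using room by blast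
      then show "homotopy f v w c \<in> orientation_relations n L"
        using homotopy_relations[OF A(2), of f B v w] relations_subset_orientation_relations[OF L, of B n] Suc by blast
    qed auto
  qed
  ultimately have "homotopy f v w (bd c) - ?E c \<in> orientation_relations n L"
    using chains.subspace_diff[OF subspace_orientation_relations] by blast
  moreover have "homotopy f v w c \<in> chain_space (Suc n) L"
  proof (rule chain_space_mem[OF _ _ _ cK])
    fix xs assume xs: "length xs = Suc n" "set xs \<in> K"
    then obtain B where "B \<in> L" "f ` set xs \<subseteq> B" "v \<in> set xs \<longrightarrow> w \<in> B" using room by blast
    then show "homotopy f v w (simplex_chain xs) \<in> (chain_space (Suc n) L :: ('b, 'k) chain set)"
      using homotopy_simplex_chains[OF simplex_chains_base[OF xs(1) order_refl], of f B v w]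
        simplex_chains_subset_chain_space[OF L, of B "Suc n"] by blast
  qed auto
  moreover have "push (f(v := w)) c - push f c = (homotopy f v w (bd c) - ?E c) + bd (homotopy f v w c)"
    by (simp add: algebra_simps)
  ultimately show ?thesis unfolding chain_boundaries_def by blast
qed

text \<open>All intermediate maps, equal to \<open>g\<close> on a finite set \<open>F\<close> and to \<open>f\<close> elsewhere, send a simplex \<open>A\<close> into
  the simplex \<open>f ` A \<union> g ` A\<close>, so vertices can be added to \<open>F\<close> one at a time. Taking for \<open>F\<close> all vertices
  of \<open>c\<close> reaches \<open>g\<close>.\<close>

lemma contiguous_homologous:
  fixes c :: "('a, 'k::field) chain"
  assumes L: "simplicial_complex L" and fg: "contiguous f g K L" and c: "c \<in> chain_cycles n K"
  shows "push g c - push f c \<in> chain_boundaries n L"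
proof -
  let ?h = "\<lambda>F x. if x \<in> F then g x else f x"
  have *: "push (?h F) c - push f c \<in> chain_boundaries n L" if "finite F" for F
    using that
  proof (induction F)
    case (insert v F)
    have "push ((?h F)(v := g v)) c - push (?h F) c \<in> chain_boundaries n L"
    proof (rule move_one_vertex[OF L _ c])
      fix A assume "A \<in> K"
      then show "\<exists>B\<in>L. ?h F ` A \<subseteq> B \<and> (v \<in> A \<longrightarrow> g v \<in> B)"
        using fg by (intro bexI[of _ "f ` A \<union> g ` A"]) (auto simp: contiguous_def)
    qed
    moreover have "(?h F)(v := g v) = ?h (insert v F)" by auto
    ultimately have "(push (?h (insert v F)) c - push (?h F) c) + (push (?h F) c - push f c) \<in> chain_boundaries n L"
      using insert.IH by (intro chain_boundaries_add) simp_all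
    then show ?case by simp
  qed simp
  define F where "F = (\<Union>xs\<in>Poly_Mapping.keys c. set xs)"
  have "push (?h F) c = push g c"
    unfolding push_def by (intro linear_extend_cong arg_cong[where f = simplex_chain] map_cong) (auto simp: F_def)
  then show ?thesis using *[of F] by (simp add: F_def)
qed

section \<open>Homology classes and induced maps\<close>

lemma ordered_chains_simps [simp]:
  "carrier (ordered_chains n K) = chain_space n K"
  "\<zero>\<^bsub>ordered_chains n K\<^esub> = 0"
  "c \<oplus>\<^bsub>ordered_chains n K\<^esub> c' = c + c'"
  "a \<odot>\<^bsub>ordered_chains n K\<^esub> c = chain_scale a c"
  by (simp_all add: ordered_chains_def chain_space_def)

lemmas chain_space_add = chains.subspace_add[OF subspace_chain_space]
  and chain_space_scale = chains.subspace_scale[OF subspace_chain_space]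
  and chain_space_0 [simp, intro] = chains.subspace_0[OF subspace_chain_space]
  and chain_space_neg = chains.subspace_neg[OF subspace_chain_space]

lemma lin_space_ordered_chains: "lin_space (ordered_chains n K)"
  by (intro lin_space.intro lin_space_axioms.intro abelian_groupI)
     (auto simp: chain_space_add chain_space_scale add.assoc add.commute chains.scale_right_distrib
       intro!: bexI[of _ "- _"] chain_space_neg)

lemma lin_subspace_ordered_chains:
  fixes W :: "('a, 'k::field) chain set"
  assumes W: "chains.subspace W" and sub: "W \<subseteq> chain_space n K"
  shows "lin_subspace W (ordered_chains n K)"
proof -
  interpret V: lin_space "ordered_chains n K :: ('k, ('a, 'k) chain) module" by (rule lin_space_ordered_chains)
  have inv: "\<ominus>\<^bsub>ordered_chains n K\<^esub> c = - c" if "c \<in> W" for c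
    using that sub by (intro V.minus_equality) (auto intro: chain_space_neg)
  show ?thesis
    by (intro lin_subspace.intro additive_subgroup.intro lin_subspace_axioms.intro
        V.lin_space_axioms V.add.subgroupI)
       (use sub W inv in \<open>auto simp: a_inv_def[symmetric] intro: chains.subspace_0 chains.subspace_add
          chains.subspace_neg chains.subspace_scale\<close>)
qed

lemma chain_hom_linear_maps:
  assumes T: "chain_hom T" and "\<And>c. c \<in> chain_space m K \<Longrightarrow> T c \<in> chain_space n L"
  shows "T \<in> linear_maps (ordered_chains m K) (ordered_chains n L)"
  using assms(2) by (auto simp: linear_maps_def module_hom.add[OF T] module_hom.scale[OF T])

text \<open>A homology class is a coset of cosets. Naming both levels lets every statement about homology be
  reduced to one about ordered chains that represent its elements.\<close>

definition oriented_class :: "nat \<Rightarrow> 'a set set \<Rightarrow> ('a, 'k::field) chain \<Rightarrow> ('a, 'k) chain set" where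
  "oriented_class n K c = orientation_relations n K +>\<^bsub>ordered_chains n K\<^esub> c"

definition homology_class :: "nat \<Rightarrow> 'a set set \<Rightarrow> ('a, 'k::field) chain \<Rightarrow> ('a, 'k) chain set set" where
  "homology_class n K c = boundaries n K +>\<^bsub>oriented_chains n K\<^esub> oriented_class n K c"

context
  fixes K :: "'a set set"
  assumes K: "simplicial_complex K"
begin

lemma lin_subspace_orientation_relations: "lin_subspace (orientation_relations n K) (ordered_chains n K)"
  by (intro lin_subspace_ordered_chains orientation_relations_subset K) simp

lemma lin_space_oriented_chains: "lin_space (oriented_chains n K)"
  unfolding oriented_chains_def
  by (rule lin_subspace.lin_space_quot[OF lin_subspace_orientation_relations])

lemma carrier_oriented_chains: "carrier (oriented_chains n K) = oriented_class n K ` chain_space n K"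
  by (auto simp: oriented_chains_def oriented_class_def)

lemma oriented_class_linear: "oriented_class n K \<in> linear_maps (ordered_chains n K) (oriented_chains n K)"
  using lin_subspace.coset_linear[OF lin_subspace_orientation_relations, of n]
  unfolding oriented_class_def oriented_chains_def .

lemma oriented_class_add:
  "c \<in> chain_space n K \<Longrightarrow> c' \<in> chain_space n K \<Longrightarrow>
     oriented_class n K (c + c') = oriented_class n K c \<oplus>\<^bsub>oriented_chains n K\<^esub> oriented_class n K c'"
  using linear_mapsD(2)[OF oriented_class_linear, of c n c'] by simp

lemma oriented_class_0: "oriented_class n K 0 = \<zero>\<^bsub>oriented_chains n K\<^esub>"
  using linear_maps_zero[OF lin_space_ordered_chains lin_space_oriented_chains oriented_class_linear, of n] by simp

lemma oriented_class_eq_zero_iff: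
  "c \<in> chain_space n K \<Longrightarrow> oriented_class n K c = \<zero>\<^bsub>oriented_chains n K\<^esub> \<longleftrightarrow> c \<in> orientation_relations n K"
  using lin_subspace.coset_eq_zero_iff[OF lin_subspace_orientation_relations, of c n]
  by (simp add: oriented_class_def oriented_chains_def)

lemma bd_linear: "bd \<in> linear_maps (ordered_chains (Suc n) K) (ordered_chains n K)"
  by (intro chain_hom_linear_maps bd_chain_space[OF K]) auto

lemma boundary_linear: "boundary n K \<in> linear_maps (oriented_chains (Suc n) K) (oriented_chains n K)"
  unfolding boundary_def oriented_chains_def bd_def[symmetric]
  by (intro quot_map_linear lin_subspace_orientation_relations bd_linear bd_orientation_relations[OF K])

lemma boundary_oriented_class:
  "c \<in> chain_space (Suc n) K \<Longrightarrow> boundary n K (oriented_class (Suc n) K c) = oriented_class n K (bd c)"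
  unfolding boundary_def oriented_class_def bd_def[symmetric]
  by (rule quot_map_coset[OF lin_subspace_orientation_relations lin_subspace_orientation_relations])
     (auto intro: bd_chain_space[OF K] bd_orientation_relations[OF K])

lemma cycles_eq: "cycles n K = (oriented_class n K ` chain_cycles n K :: ('a, 'k::field) chain set set)"
proof (cases n)
  case 0
  then show ?thesis by (auto simp: cycles_def chain_cycles_def carrier_oriented_chains)
next
  case (Suc m)
  have "boundary m K (oriented_class (Suc m) K c) = \<zero>\<^bsub>oriented_chains m K\<^esub> \<longleftrightarrow> bd c \<in> orientation_relations m K"
    if "c \<in> chain_space (Suc m) K" for c :: "('a, 'k) chain"
    unfolding boundary_oriented_class[OF that] by (rule oriented_class_eq_zero_iff[OF bd_chain_space[OF K that]])
  then show ?thesis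
    unfolding Suc by (auto simp: cycles_def chain_cycles_def a_kernel_def' carrier_oriented_chains)
qed

lemma lin_subspace_cycles: "lin_subspace (cycles n K) (oriented_chains n K)"
  unfolding cycles_def
  by (cases n) (auto intro!: lin_subspace_carrier lin_subspace_kernel lin_space_oriented_chains boundary_linear)

lemma boundaries_eq: "boundaries n K = (\<lambda>b. oriented_class n K (bd b)) ` chain_space (Suc n) K"
  by (auto simp: boundaries_def carrier_oriented_chains boundary_oriented_class image_image)

lemma lin_subspace_boundaries: "lin_subspace (boundaries n K) (oriented_chains n K)"
  unfolding boundaries_def
  by (intro lin_subspace_image lin_space_oriented_chains boundary_linear)

lemma boundaries_subset_cycles: "boundaries n K \<subseteq> cycles n K"
  using chains.subspace_0[OF subspace_orientation_relations]
  by (auto simp: boundaries_eq cycles_eq chain_cycles_def bd_bd intro!: imageI bd_chain_space[OF K])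

text \<open>Homology is the quotient of the space of cycles, while addition, scaling and cosets are those of all oriented
  chains; restricting the carrier does not change them.\<close>

lemma lin_subspace_boundaries_cycles:
  "lin_subspace (boundaries n K) (oriented_chains n K\<lparr>carrier := cycles n K\<rparr>)"
  by (intro lin_subspace_restrict lin_subspace_boundaries lin_subspace_cycles boundaries_subset_cycles)

lemma lin_space_homology: "lin_space (homology n K)"
  unfolding homology_def by (rule lin_subspace.lin_space_quot[OF lin_subspace_boundaries_cycles])

lemma carrier_homology: "carrier (homology n K) = homology_class n K ` chain_cycles n K"
  by (auto simp: homology_def homology_class_def a_r_coset_def r_coset_def cycles_eq)

lemma homology_class_eqI:
  assumes c: "c \<in> chain_space n K" and c': "c' \<in> chain_space n K" and "c' - c \<in> chain_boundaries n K"
  shows "homology_class n K c = homology_class n K c'"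
proof -
  interpret R: lin_subspace "orientation_relations n K" "ordered_chains n K"
    by (rule lin_subspace_orientation_relations)
  interpret B: lin_subspace "boundaries n K" "oriented_chains n K" by (rule lin_subspace_boundaries)
  obtain r b where rb: "c' - c = r + bd b" "r \<in> orientation_relations n K" "b \<in> chain_space (Suc n) K"
    using assms(3) unfolding chain_boundaries_def by blast
  have b: "bd b \<in> chain_space n K" by (rule bd_chain_space[OF K rb(3)])
  have "c' = r + (bd b + c)" using rb(1) by (simp add: algebra_simps)
  then have "oriented_class n K c' = oriented_class n K (bd b + c)"
    using R.coset_eqI[of "bd b + c" r] rb(2) b c by (simp add: oriented_class_def chain_space_add)
  also have "\<dots> = oriented_class n K (bd b) \<oplus>\<^bsub>oriented_chains n K\<^esub> oriented_class n K c"
    using b c by (rule oriented_class_add)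
  finally show ?thesis
    unfolding homology_class_def
    using B.coset_eqI[of "oriented_class n K c" "oriented_class n K (bd b)"] c rb(3)
    by (simp add: boundaries_eq carrier_oriented_chains)
qed

end

context
  fixes K :: "'a set set" and L :: "'b set set" and f :: "'a \<Rightarrow> 'b"
  assumes K: "simplicial_complex K" and L: "simplicial_complex L" and f: "simplicial_map f K L"
begin

lemma push_linear: "push f \<in> linear_maps (ordered_chains n K) (ordered_chains n L)"
  by (intro chain_hom_linear_maps push_chain_space[OF f]) auto

lemma chain_map_linear: "chain_map n L f \<in> linear_maps (oriented_chains n K) (oriented_chains n L)"
  unfolding chain_map_def oriented_chains_def push_def[symmetric]
  by (intro quot_map_linear lin_subspace_orientation_relations K L push_linear push_orientation_relations[OF L f])

lemma chain_map_oriented_class: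
  "c \<in> chain_space n K \<Longrightarrow> chain_map n L f (oriented_class n K c) = oriented_class n L (push f c)"
  unfolding chain_map_def oriented_class_def push_def[symmetric]
  by (rule quot_map_coset[OF lin_subspace_orientation_relations[OF K] lin_subspace_orientation_relations[OF L]])
     (auto intro: push_chain_space[OF f] push_orientation_relations[OF L f])

lemma chain_map_cycles: "z \<in> cycles n K \<Longrightarrow> chain_map n L f z \<in> cycles n L"
  unfolding cycles_eq[OF K] cycles_eq[OF L]
proof (elim imageE)
  fix c assume c: "c \<in> chain_cycles n K" and z: "z = oriented_class n K c"
  have "c \<in> chain_space n K" using c by (simp add: chain_cycles_def)
  then show "chain_map n L f z \<in> oriented_class n L ` chain_cycles n L"
    unfolding z by (simp add: chain_map_oriented_class push_chain_cycles[OF L f c])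
qed

lemma chain_map_boundaries: "z \<in> boundaries n K \<Longrightarrow> chain_map n L f z \<in> boundaries n L"
  by (auto simp: boundaries_eq[OF K] boundaries_eq[OF L] chain_map_oriented_class bd_chain_space[OF K] push_bd
      intro!: imageI push_chain_space[OF f])

lemma homology_map_class:
  assumes "c \<in> chain_space n K"
  shows "homology_map n L f (homology_class n K c) = homology_class n L (push f c)"
  using assms
  unfolding homology_map_def homology_class_def chain_map_oriented_class[OF assms, symmetric]
  by (intro quot_map_coset[OF lin_subspace_boundaries[OF K] lin_subspace_boundaries[OF L]]
        linear_mapsD[OF chain_map_linear] chain_map_boundaries)
     (auto simp: carrier_oriented_chains[OF K])

lemma homology_map_linear:
  "homology_map n L f \<in> linear_maps (homology n K :: ('k::field, ('a, 'k) chain set set) module) (homology n L)"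
proof -
  let ?ZK = "oriented_chains n K\<lparr>carrier := cycles n K\<rparr> :: ('k, ('a, 'k) chain set) module"
  let ?ZL = "oriented_chains n L\<lparr>carrier := cycles n L\<rparr> :: ('k, ('b, 'k) chain set) module"
  have "chain_map n L f \<in> linear_maps ?ZK ?ZL"
    using additive_subgroup.a_subset[OF lin_subspace.axioms(2)[OF lin_subspace_cycles[OF K]], of n]
    by (intro linear_maps_restrict chain_map_linear chain_map_cycles)
  then have "quot_map ?ZL (boundaries n L) (chain_map n L f) \<in>
      linear_maps (quot_module ?ZK (boundaries n K)) (quot_module ?ZL (boundaries n L))"
    by (intro quot_map_linear lin_subspace_boundaries_cycles K L chain_map_boundaries)
  moreover have "quot_map ?ZL (boundaries n L) (chain_map n L f) = homology_map n L f"
    by (simp add: homology_map_def quot_map_def[abs_def] a_r_coset_def r_coset_def)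
  ultimately show ?thesis by (simp only: homology_def)
qed

end

section \<open>Interleavings with the zero module\<close>

text \<open>Maps into and out of the zero module carry no information, so the only condition left is the one
  on the composite \<open>V\<^bsub>s\<^esub> \<rightarrow> 0 \<rightarrow> V\<^bsub>s + 2 e\<^esub>\<close>, which has to be the transition map.\<close>

lemma interleaving_zero:
  fixes V :: "('k, 'v) pmodule"
  assumes "0 \<le> e"
    and sp: "\<And>s. 0 \<le> s \<Longrightarrow> lin_space (pspace V s)"
    and tr: "\<And>s t. 0 \<le> s \<Longrightarrow> s \<le> t \<Longrightarrow> ptrans V s t \<zero>\<^bsub>pspace V s\<^esub> = \<zero>\<^bsub>pspace V t\<^esub>"
    and vanish: "\<And>s x. 0 \<le> s \<Longrightarrow> x \<in> carrier (pspace V s) \<Longrightarrow>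
        ptrans V s (s + 2 * e) x = \<zero>\<^bsub>pspace V (s + 2 * e)\<^esub>"
  shows "interleaving e V zero_pmodule (\<lambda>_ _. ()) (\<lambda>s _. \<zero>\<^bsub>pspace V (s + e)\<^esub>)"
proof -
  have ab: "abelian_group (pspace V s)" if "0 \<le> s" for s
    using sp[OF that] by (simp add: lin_space_def)
  have z: "\<zero>\<^bsub>pspace V s\<^esub> \<in> carrier (pspace V s)"
    "\<zero>\<^bsub>pspace V s\<^esub> \<oplus>\<^bsub>pspace V s\<^esub> \<zero>\<^bsub>pspace V s\<^esub> = \<zero>\<^bsub>pspace V s\<^esub>"
    "a \<odot>\<^bsub>pspace V s\<^esub> \<zero>\<^bsub>pspace V s\<^esub> = \<zero>\<^bsub>pspace V s\<^esub>" if "0 \<le> s" for s a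
    using abelian_groupE[OF ab[OF that]] lin_space.smult_zero[OF sp[OF that]] by auto
  show ?thesis
    unfolding interleaving_def natural_shift_def
    using \<open>0 \<le> e\<close> z tr vanish
    by (auto simp: zero_pmodule_def linear_maps_def add.assoc)
qed

lemma interleaving_distance_le:
  assumes "interleaving e V W P Q" and "0 \<le> e"
  shows "interleaving_distance V W \<le> ennreal e"
  unfolding interleaving_distance_def using assms by (intro Inf_lower) auto

section \<open>Persistent cost\<close>

lemma contiguous_homology_map:
  assumes K: "simplicial_complex K" and L: "simplicial_complex L" and fg: "contiguous f g K L"
    and x: "x \<in> carrier (homology n K)"
  shows "homology_map n L f x = homology_map n L g x"
proof -
  have simp_f: "simplicial_map f K L" and simp_g: "simplicial_map g K L"
    using fg L unfolding simplicial_map_def contiguous_def simplicial_complex_def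
    by (metis Un_upper1 Un_upper2 UnI1 image_is_empty K simplicial_complex_def)+
  obtain c where c: "c \<in> chain_cycles n K" and xc: "x = homology_class n K c"
    using x by (auto simp: carrier_homology[OF K])
  have cK: "c \<in> chain_space n K" using c by (simp add: chain_cycles_def)
  show ?thesis
    unfolding xc homology_map_class[OF K L simp_f cK] homology_map_class[OF K L simp_g cK]
    by (intro homology_class_eqI[OF L] push_chain_space[OF simp_f cK] push_chain_space[OF simp_g cK]
        contiguous_homologous[OF L fg c])
qed

lemma homology_map_comp:
  assumes K: "simplicial_complex K" and L: "simplicial_complex L" and M: "simplicial_complex M"
    and f: "simplicial_map f K L" and g: "simplicial_map g L M"
    and x: "x \<in> carrier (homology n K)"
  shows "homology_map n M g (homology_map n L f x) = homology_map n M (\<lambda>v. g (f v)) x"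
proof -
  have gf: "simplicial_map (\<lambda>v. g (f v)) K M"
    using f g unfolding simplicial_map_def by (metis image_image)
  obtain c where c: "c \<in> chain_cycles n K" and xc: "x = homology_class n K c"
    using x by (auto simp: carrier_homology[OF K])
  have cK: "c \<in> chain_space n K" using c by (simp add: chain_cycles_def)
  show ?thesis
    unfolding xc homology_map_class[OF K L f cK] homology_map_class[OF K M gf cK]
      homology_map_class[OF L M g push_chain_space[OF f cK]] push_push ..
qed

text \<open>In this form the scale is compared with pairwise distances, and no diameters remain.\<close>

lemma vietoris_rips_iff:
  "A \<in> vietoris_rips s X \<longleftrightarrow> finite A \<and> A \<noteq> {} \<and> A \<subseteq> X \<and> (\<forall>x\<in>A. \<forall>y\<in>A. dist x y \<le> s)"
proof -
  have "diameter A \<le> s \<longleftrightarrow> (\<forall>x\<in>A. \<forall>y\<in>A. dist x y \<le> s)" if A: "finite A" "A \<noteq> {}"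
  proof
    assume "diameter A \<le> s"
    then show "\<forall>x\<in>A. \<forall>y\<in>A. dist x y \<le> s"
      using diameter_bounded_bound[OF finite_imp_bounded[OF A(1)]] by fastforce
  next
    assume "\<forall>x\<in>A. \<forall>y\<in>A. dist x y \<le> s"
    then show "diameter A \<le> s"
      using A by (auto simp: diameter_def intro!: cSUP_least)
  qed
  then show ?thesis by (auto simp: vietoris_rips_def)
qed

lemma simplicial_complex_vietoris_rips: "simplicial_complex (vietoris_rips s X)"
  by (auto simp: simplicial_complex_def vietoris_rips_iff subset_iff intro: finite_subset[OF subsetI])

lemma simplicial_map_vietoris_rips:
  assumes "\<And>x. x \<in> X \<Longrightarrow> f x \<in> Y"
    and "\<And>x x'. x \<in> X \<Longrightarrow> x' \<in> X \<Longrightarrow> dist x x' \<le> s \<Longrightarrow> dist (f x) (f x') \<le> t"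
  shows "simplicial_map f (vietoris_rips s X) (vietoris_rips t Y)"
  using assms by (auto simp: simplicial_map_def vietoris_rips_iff subset_iff)

lemma contiguous_vietoris_rips:
  assumes "\<And>x. x \<in> X \<Longrightarrow> f x \<in> Y" and "\<And>x. x \<in> X \<Longrightarrow> g x \<in> Y"
    and "\<And>x x'. x \<in> X \<Longrightarrow> x' \<in> X \<Longrightarrow> dist x x' \<le> s \<Longrightarrow>
      dist (f x) (f x') \<le> t \<and> dist (f x) (g x') \<le> t \<and> dist (g x) (g x') \<le> t"
  shows "contiguous f g (vietoris_rips s X) (vietoris_rips t Y)"
  unfolding contiguous_def
proof (intro ballI vietoris_rips_iff[THEN iffD2] conjI)
  fix A u v
  assume A: "A \<in> vietoris_rips s X" and u: "u \<in> f ` A \<union> g ` A" and v: "v \<in> f ` A \<union> g ` A"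
  have "dist (f x) (f x') \<le> t \<and> dist (f x) (g x') \<le> t \<and> dist (g x) (g x') \<le> t" if "x \<in> A" "x' \<in> A" for x x'
    using A that by (intro assms(3)) (auto simp: vietoris_rips_iff)
  then show "dist u v \<le> t"
    using u v by (auto simp: dist_commute[of "g _" "f _"])
qed (use assms(1,2) in \<open>auto simp: vietoris_rips_iff subset_iff\<close>)

text \<open>The map \<open>g\<close> is an inverse of \<open>f\<close> up to contiguity. Its stretch is at most \<open>\<delta> + 2\<eta>\<close>, because
  \<open>d(g y, g y') \<le> d(f g y, f g y') + \<delta>\<close> and both points \<open>f g y\<close>, \<open>f g y'\<close> move by at most \<open>\<eta>\<close>. Interleavings with
  zero concern the transition maps over \<open>2 e\<close>, so all simplicial maps are taken with target
  scale \<open>s + 2 e\<close>.\<close>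

lemma persistent_cost_le_quasi_inverse:
  fixes X :: "'a::metric_space set" and Y :: "'b::metric_space set"
  assumes "0 \<le> e" and fXY: "\<And>x. x \<in> X \<Longrightarrow> f x \<in> Y" and gYX: "\<And>y. y \<in> Y \<Longrightarrow> g y \<in> X"
    and lip: "\<And>x x'. x \<in> X \<Longrightarrow> x' \<in> X \<Longrightarrow> dist (f x) (f x') \<le> dist x x'"
    and dis: "\<And>x x'. x \<in> X \<Longrightarrow> x' \<in> X \<Longrightarrow> dist x x' \<le> dist (f x) (f x') + \<delta>"
    and net: "\<And>y. y \<in> Y \<Longrightarrow> dist (f (g y)) y \<le> \<eta>"
    and e: "\<delta> + 2 * \<eta> \<le> e" and nonneg: "0 \<le> \<delta>" "0 \<le> \<eta>"
  shows "persistent_cost TYPE('k::field) d X Y f \<le> ennreal e"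
proof -
  define K where "K = (\<lambda>s. vietoris_rips s X)"
  define L where "L = (\<lambda>s. vietoris_rips s Y)"
  let ?V = "vr_homology d X :: ('k, ('a, 'k) chain set set) pmodule"
  let ?W = "vr_homology d Y :: ('k, ('b, 'k) chain set set) pmodule"
  let ?F = "vr_homology_map d Y f :: real \<Rightarrow> ('a, 'k) chain set set \<Rightarrow> ('b, 'k) chain set set"
  have V: "pspace ?V s = homology d (K s)" "ptrans ?V s t = homology_map d (K t) (\<lambda>x. x)"
    and W: "pspace ?W s = homology d (L s)" "ptrans ?W s t = homology_map d (L t) (\<lambda>x. x)"
    and F: "?F s = homology_map d (L s) f" for s t
    by (simp_all add: vr_homology_def vr_homology_map_def K_def L_def)
  have K: "simplicial_complex (K s)" and L: "simplicial_complex (L s)" for s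
    by (simp_all add: K_def L_def simplicial_complex_vietoris_rips)

  have gdist: "dist (g y) (g y') \<le> dist y y' + (\<delta> + 2 * \<eta>)" if "y \<in> Y" "y' \<in> Y" for y y'
  proof -
    have "dist (g y) (g y') \<le> dist (f (g y)) (f (g y')) + \<delta>"
      using that by (intro dis gYX)
    also have "dist (f (g y)) (f (g y')) \<le> dist y y' + 2 * \<eta>"
      using net[OF that(1)] net[OF that(2)] dist_triangle[of "f (g y)" "f (g y')" y]
        dist_triangle[of y "f (g y')" y'] by (simp add: dist_commute)
    finally show ?thesis by simp
  qed
  have inclK: "simplicial_map (\<lambda>x. x) (K s) (K t)" and inclL: "simplicial_map (\<lambda>x. x) (L s) (L t)"
    and f: "simplicial_map f (K s) (L t)" if "s \<le> t" for s t
    unfolding K_def L_def using that lip fXY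
    by (auto intro!: simplicial_map_vietoris_rips) (meson lip order_trans)
  have g: "simplicial_map g (L s) (K (s + 2 * e))" for s
    unfolding K_def L_def
  proof (rule simplicial_map_vietoris_rips)
    fix y y' assume "y \<in> Y" "y' \<in> Y" "dist y y' \<le> s"
    then show "dist (g y) (g y') \<le> s + 2 * e" using gdist[of y y'] e \<open>0 \<le> e\<close> by linarith
  qed (rule gYX)
  have gf: "contiguous (\<lambda>x. g (f x)) (\<lambda>x. x) (K s) (K (s + 2 * e))" for s
    unfolding K_def
  proof (rule contiguous_vietoris_rips)
    fix x x' assume x: "x \<in> X" "x' \<in> X" "dist x x' \<le> s"
    have "dist (g (f x)) x' \<le> dist (f (g (f x))) (f x') + \<delta>"
      using x by (intro dis gYX fXY)
    moreover have "dist (f (g (f x))) (f x') \<le> \<eta> + dist x x'"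
      using net[OF fXY[OF x(1)]] lip[OF x(1,2)] dist_triangle[of "f (g (f x))" "f x'" "f x"] by linarith
    moreover have "dist (g (f x)) (g (f x')) \<le> dist (f x) (f x') + (\<delta> + 2 * \<eta>)"
      using x by (intro gdist fXY)
    ultimately show "dist (g (f x)) (g (f x')) \<le> s + 2 * e \<and> dist (g (f x)) x' \<le> s + 2 * e \<and> dist x x' \<le> s + 2 * e"
      using x lip[OF x(1,2)] e nonneg by linarith
  qed (auto intro: fXY gYX)
  have fg: "contiguous (\<lambda>y. f (g y)) (\<lambda>y. y) (L s) (L (s + 2 * e))" for s
    unfolding L_def
  proof (rule contiguous_vietoris_rips)
    fix y y' assume y: "y \<in> Y" "y' \<in> Y" "dist y y' \<le> s"
    have "dist (f (g y)) y' \<le> \<eta> + dist y y'"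
      using net[OF y(1)] dist_triangle[of "f (g y)" y' y] by linarith
    moreover have "dist (f (g y)) (f (g y')) \<le> dist (g y) (g y')"
      using y by (intro lip gYX)
    ultimately show "dist (f (g y)) (f (g y')) \<le> s + 2 * e \<and> dist (f (g y)) y' \<le> s + 2 * e \<and> dist y y' \<le> s + 2 * e"
      using y gdist[OF y(1,2)] e nonneg by linarith
  qed (auto intro: fXY gYX)

  have natural: "homology_map d (L t) (\<lambda>y. y) (homology_map d (L s) f x) =
      homology_map d (L t) f (homology_map d (K t) (\<lambda>x. x) x)"
    if "s \<le> t" and "x \<in> carrier (homology d (K s))" for s t and x :: "('a, 'k) chain set set"
    using homology_map_comp[OF K L L f[OF order_refl] inclL[OF that(1)] that(2)]
      homology_map_comp[OF K K L inclK[OF that(1)] f[OF order_refl] that(2)] by simp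

  \<comment> \<open>On the kernel, the transition map is \<open>g\<^sub>* f\<^sub>*\<close> and therefore zero.\<close>
  have "interleaving e (ker_pmodule ?V ?W ?F) zero_pmodule (\<lambda>_ _. ())
      (\<lambda>s _. \<zero>\<^bsub>pspace (ker_pmodule ?V ?W ?F) (s + e)\<^esub>)"
  proof (rule interleaving_zero[OF \<open>0 \<le> e\<close>])
    fix s :: real assume "0 \<le> s"
    show "lin_space (pspace (ker_pmodule ?V ?W ?F) s)"
      unfolding ker_pmodule_def V W F
      by (simp add: V W F lin_space_restrict lin_subspace_kernel lin_space_homology K L homology_map_linear f)
    fix x assume "x \<in> carrier (pspace (ker_pmodule ?V ?W ?F) s)"
    then have x: "x \<in> carrier (homology d (K s))" and x0: "homology_map d (L s) f x = \<zero>\<^bsub>homology d (L s)\<^esub>"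
      by (simp_all add: ker_pmodule_def V W F a_kernel_def')
    have "homology_map d (K (s + 2 * e)) (\<lambda>x. x) x = homology_map d (K (s + 2 * e)) (\<lambda>x. g (f x)) x"
      by (rule contiguous_homology_map[OF K K gf x, symmetric])
    also have "\<dots> = homology_map d (K (s + 2 * e)) g (homology_map d (L s) f x)"
      by (rule homology_map_comp[OF K L K f[OF order_refl] g x, symmetric])
    also have "\<dots> = \<zero>\<^bsub>homology d (K (s + 2 * e))\<^esub>"
      unfolding x0 by (intro linear_maps_zero lin_space_homology K L homology_map_linear g)
    finally show "ptrans (ker_pmodule ?V ?W ?F) s (s + 2 * e) x = \<zero>\<^bsub>pspace (ker_pmodule ?V ?W ?F) (s + 2 * e)\<^esub>"
      by (simp add: ker_pmodule_def V)
  next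
    fix s t :: real assume "s \<le> t"
    have "homology_map d (K t) (\<lambda>x. x) \<zero>\<^bsub>homology d (K s)\<^esub> = (\<zero>\<^bsub>homology d (K t)\<^esub> :: ('a, 'k) chain set set)"
      by (intro linear_maps_zero lin_space_homology K homology_map_linear inclK \<open>s \<le> t\<close>)
    then show "ptrans (ker_pmodule ?V ?W ?F) s t \<zero>\<^bsub>pspace (ker_pmodule ?V ?W ?F) s\<^esub> =
        \<zero>\<^bsub>pspace (ker_pmodule ?V ?W ?F) t\<^esub>"
      by (simp add: ker_pmodule_def V)
  qed
  note ker = interleaving_distance_le[OF this \<open>0 \<le> e\<close>]

  \<comment> \<open>On \<open>Y\<close>, the transition map is \<open>f\<^sub>* g\<^sub>*\<close> and therefore zero modulo the image of \<open>f\<^sub>*\<close>.\<close>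
  define I where "I = (\<lambda>s. homology_map d (L s) f ` carrier (homology d (K s) :: ('k, ('a, 'k) chain set set) module))"
  have I: "lin_subspace (I s) (homology d (L s))" for s
    unfolding I_def by (intro lin_subspace_image lin_space_homology K L homology_map_linear f order_refl)
  have coker_space: "pspace (coker_pmodule ?V ?W ?F) s = quot_module (homology d (L s)) (I s)"
    and coker_trans: "ptrans (coker_pmodule ?V ?W ?F) s t =
      quot_map (homology d (L t)) (I t) (homology_map d (L t) (\<lambda>y. y))" for s t
    by (simp_all add: coker_pmodule_def V W F I_def)
  have trans_I: "homology_map d (L t) (\<lambda>y. y) y \<in> I t" if st: "s \<le> t" and yI: "y \<in> I s" for s t y
  proof -
    obtain x where x: "x \<in> carrier (homology d (K s))" and y: "y = homology_map d (L s) f x"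
      using yI by (auto simp: I_def)
    have "homology_map d (K t) (\<lambda>x. x) x \<in> carrier (homology d (K t))"
      by (rule linear_mapsD(1)[OF homology_map_linear[OF K K inclK[OF st]] x])
    then show ?thesis unfolding y natural[OF st x] I_def by (rule imageI)
  qed
  have "interleaving e (coker_pmodule ?V ?W ?F) zero_pmodule (\<lambda>_ _. ())
      (\<lambda>s _. \<zero>\<^bsub>pspace (coker_pmodule ?V ?W ?F) (s + e)\<^esub>)"
  proof (rule interleaving_zero[OF \<open>0 \<le> e\<close>])
    fix s :: real assume "0 \<le> s"
    show "lin_space (pspace (coker_pmodule ?V ?W ?F) s)"
      unfolding coker_space by (rule lin_subspace.lin_space_quot[OF I])
    fix C assume "C \<in> carrier (pspace (coker_pmodule ?V ?W ?F) s)"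
    then obtain y where y: "y \<in> carrier (homology d (L s))" and C: "C = I s +>\<^bsub>homology d (L s)\<^esub> y"
      by (auto simp: coker_space)
    let ?t = "s + 2 * e"
    have st: "s \<le> ?t" using \<open>0 \<le> e\<close> by simp
    note incl = linear_mapsD[OF homology_map_linear[OF L L inclL[OF st]]]
    have "homology_map d (L ?t) (\<lambda>y. y) y = homology_map d (L ?t) (\<lambda>y. f (g y)) y"
      by (rule contiguous_homology_map[OF L L fg y, symmetric])
    also have "\<dots> = homology_map d (L ?t) f (homology_map d (K ?t) g y)"
      by (rule homology_map_comp[OF L K L g f[OF order_refl] y, symmetric])
    also have "\<dots> \<in> I ?t"
      unfolding I_def using y by (intro imageI linear_mapsD(1)[OF homology_map_linear[OF L K g]])
    finally have "I ?t +>\<^bsub>homology d (L ?t)\<^esub> homology_map d (L ?t) (\<lambda>y. y) y = I ?t"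
      using lin_subspace.coset_eq_zero_iff[OF I] incl(1)[OF y] by blast
    moreover have "quot_map (homology d (L ?t)) (I ?t) (homology_map d (L ?t) (\<lambda>y. y)) C =
        I ?t +>\<^bsub>homology d (L ?t)\<^esub> homology_map d (L ?t) (\<lambda>y. y) y"
      unfolding C by (rule quot_map_coset[OF I I incl(1,2) trans_I[OF st] y])
    ultimately show "ptrans (coker_pmodule ?V ?W ?F) s ?t C = \<zero>\<^bsub>pspace (coker_pmodule ?V ?W ?F) ?t\<^esub>"
      by (simp add: coker_space coker_trans)
  next
    fix s t :: real assume "s \<le> t"
    show "ptrans (coker_pmodule ?V ?W ?F) s t \<zero>\<^bsub>pspace (coker_pmodule ?V ?W ?F) s\<^esub> =
        \<zero>\<^bsub>pspace (coker_pmodule ?V ?W ?F) t\<^esub>"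
      unfolding coker_space coker_trans
      by (intro linear_maps_zero lin_subspace.lin_space_quot I quot_map_linear homology_map_linear L
          inclL \<open>s \<le> t\<close> trans_I[OF \<open>s \<le> t\<close>])
  qed
  note coker = interleaving_distance_le[OF this \<open>0 \<le> e\<close>]
  show ?thesis
    using ker coker by (simp add: persistent_cost_def Let_def)
qed

lemma hausdorff_distance_net:
  assumes "hausdorff_distance (f ` X) Y < ennreal r" and "y \<in> Y"
  shows "\<exists>x\<in>X. dist (f x) y < r"
proof -
  have "(INF a\<in>f ` X. ennreal (dist a y)) \<le> hausdorff_distance (f ` X) Y"
    unfolding hausdorff_distance_def
    using assms(2) by (intro order_trans[OF SUP_upper max.cobounded2])
  then have "(INF a\<in>f ` X. ennreal (dist a y)) < ennreal r" using assms(1) by (rule order_le_less_trans)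
  then show ?thesis by (auto simp: INF_less_iff ennreal_less_iff)
qed

text \<open>It suffices to bound the cost by every \<open>z\<close> above the right-hand side. If \<open>z\<close> is finite, so are the
  distortion and the Hausdorff distance, and the estimate takes place among real numbers.\<close>

theorem theorem2p11:
  fixes X :: "'a::metric_space set" and Y :: "'b::metric_space set"
    and f :: "'a \<Rightarrow> 'b" and d :: nat
  assumes "compact X" and "compact Y"
    and "f \<in> X \<rightarrow> Y" and "1-lipschitz_on X f"
  shows "persistent_cost TYPE('k::field) d X Y f \<le> distortion X f + 2 * hausdorff_distance (f ` X) Y"
proof (rule dense_ge)
  fix z assume z: "distortion X f + 2 * hausdorff_distance (f ` X) Y < z"
  show "persistent_cost TYPE('k) d X Y f \<le> z"
  proof (cases z)
    case top
    then show ?thesis by simp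
  next
    case (real e)
    obtain \<delta> where \<delta>: "0 \<le> \<delta>" "distortion X f = ennreal \<delta>"
      using z by (cases "distortion X f") (auto simp: top_unique)
    obtain h where h: "0 \<le> h" "hausdorff_distance (f ` X) Y = ennreal h"
      using z by (cases "hausdorff_distance (f ` X) Y") (auto simp: ennreal_mult_top)
    have lt: "\<delta> + 2 * h < e"
    proof -
      have "ennreal (\<delta> + 2 * h) = distortion X f + 2 * hausdorff_distance (f ` X) Y"
        using \<delta> h by (simp add: ennreal_mult)
      then have "ennreal (\<delta> + 2 * h) < ennreal e" using z real by simp
      then show ?thesis using \<delta> h by (subst (asm) ennreal_less_iff) simp_all
    qed
    \<comment> \<open>The slack between \<open>\<delta> + 2 * h\<close> and \<open>e\<close> allows a strict bound \<open>\<eta> > h\<close>; the infimum in the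
      Hausdorff distance then provides a point of \<open>X\<close> for each \<open>y\<close>.\<close>
    define \<eta> where "\<eta> = (e - \<delta>) / 2"
    have \<eta>: "h < \<eta>" "\<delta> + 2 * \<eta> \<le> e" using lt by (simp_all add: \<eta>_def field_simps)
    have "hausdorff_distance (f ` X) Y < ennreal \<eta>"
      using \<eta> h by (simp add: ennreal_less_iff)
    from hausdorff_distance_net[OF this] obtain g where g: "\<And>y. y \<in> Y \<Longrightarrow> g y \<in> X \<and> dist (f (g y)) y < \<eta>"
      by metis
    have lip: "dist (f x) (f x') \<le> dist x x'" if "x \<in> X" "x' \<in> X" for x x'
      using lipschitz_onD[OF assms(4) that] by simp
    have dis: "dist x x' \<le> dist (f x) (f x') + \<delta>" if "x \<in> X" "x' \<in> X" for x x'
    proof -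
      have "ennreal \<bar>dist (f x) (f x') - dist x x'\<bar> \<le> distortion X f"
        unfolding distortion_def using that by (intro SUP_upper2[of "(x, x')"]) auto
      then show ?thesis using \<delta> by (simp add: ennreal_le_iff)
    qed
    show ?thesis
      unfolding real
      by (rule persistent_cost_le_quasi_inverse[where g = g and \<delta> = \<delta> and \<eta> = \<eta>])
         (use real assms(3) g lip dis \<eta> \<delta> h in \<open>auto intro: less_imp_le simp: Pi_iff\<close>)
  qed
qed

end
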